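(* Let $p\in(0,1)$ and let the offspring distribution be $q_n=p(1-p)^{n-2}$ for $n\ge2$ (and $q_0=q_1=0$). For every $k\ge2$ and every $\mathbf p\in\mathscr P_k$ such that $\mathbf p_1=\mathbf p_2>\mathbf p_3\ge\dots\ge\mathbf p_k$, the sequence $\mathbf p(m)$ converges, as $m\to\infty$, to $\left(\alpha,\frac{1-\alpha}{2},\frac{1-\alpha}{2},0_{k-2}\right)$, where $$\alpha=\frac{-3p+(p(p+8))^{1/2}}{4(1-p)}.$$
   Context: $\mathscr P_k:=\{\mathbf p=(\mathbf p_0,\dots,\mathbf p_k)\in(\mathbb R_+)^{k+1}:\sum_{i=0}^k\mathbf p_i=1,\ \mathbf p_0<1\}$. $0_r$ denotes $r$ zero coordinates (for $k=2$ the condition on $\mathbf p_3,\dots,\mathbf p_k$ is void). The map $H:\mathscr P_k\to\mathscr P_k$ is defined, for $1\le i\le k$, by $$H_i(\mathbf p)=\sum_{n\ge2}q_n\sum_{m_0=0}^{n-1}\binom{n}{m_0}\mathbf p_0^{m_0}\sum_{(m_1,\dots,m_k)\in S^i_{n-m_0}}\binom{n-m_0}{m_1,\dots,m_k}\prod_{j=1}^k\mathbf p_j^{m_j},\qquad H_0(\mathbf p)=1-\sum_{j=1}^kH_j(\mathbf p),$$ with $S^i_r=\{(m_1,\dots,m_k)\in\mathbb N^k:\ m_j<m_i\ \forall j\ne i,\ \sum_{j=1}^km_j=r\}$. For $\mathbf p\in\mathscr P_k$, $\mathbf p(m):=H^m(\mathbf p)$ (the $m$-th iterate); it is the law of the root's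 state in a Galton–Watson tree of height $m$ with offspring law $q$, when the leaves have i.i.d. states of law $\mathbf p$ ($0$ meaning undecided) and each parent takes the strict relative-majority opinion among its decided children, being undecided in case of a tie for the maximum or if all children are undecided. *)

theory Defs
  imports "HOL-Analysis.Analysis"
begin

text \<open>
  A vector \<open>(x\<^sub>0, \<dots>, x\<^sub>k)\<close> is a function \<open>x :: nat \<Rightarrow> real\<close> vanishing above \<open>k\<close>; a tuple
  \<open>(m\<^sub>1, \<dots>, m\<^sub>k)\<close> is a function \<open>m :: nat \<Rightarrow> nat\<close> vanishing outside \<open>{1..k}\<close>. Requiring the
  value 0 at unused indices makes these functions correspond one-to-one to the tuples, so that
  sums over sets of them are sums over sets of tuples.
\<close>

definition opinion_laws :: "nat \<Rightarrow> (nat \<Rightarrow> real) set" where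
  "opinion_laws k =
     {x. (\<forall>i\<le>k. 0 \<le> x i) \<and> (\<forall>i>k. x i = 0) \<and> (\<Sum>i=0..k. x i) = 1 \<and> x 0 < 1}"

definition majority_counts :: "nat \<Rightarrow> nat \<Rightarrow> nat \<Rightarrow> (nat \<Rightarrow> nat) set" where
  "majority_counts k i r =
     {m. (\<forall>j. j \<notin> {1..k} \<longrightarrow> m j = 0) \<and> (\<forall>j\<in>{1..k}. j \<noteq> i \<longrightarrow> m j < m i) \<and>
         (\<Sum>j=1..k. m j) = r}"

text \<open>Only used when \<open>m\<^sub>1 + \<dots> + m\<^sub>k = r\<close>, where the quotient is a natural number.\<close>

definition multinomial_coeff :: "nat \<Rightarrow> nat \<Rightarrow> (nat \<Rightarrow> nat) \<Rightarrow> real" where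
  "multinomial_coeff k r m = fact r / (\<Prod>j=1..k. fact (m j))"

definition majority_prob :: "(nat \<Rightarrow> real) \<Rightarrow> nat \<Rightarrow> (nat \<Rightarrow> real) \<Rightarrow> nat \<Rightarrow> real" where
  "majority_prob q k x i =
     (\<Sum>\<^sub>\<infinity>n\<in>{2..}. q n *
        (\<Sum>m0=0..n-1. real (n choose m0) * x 0 ^ m0 *
           (\<Sum>m\<in>majority_counts k i (n - m0).
              multinomial_coeff k (n - m0) m * (\<Prod>j=1..k. x j ^ m j))))"

definition majority_map :: "(nat \<Rightarrow> real) \<Rightarrow> nat \<Rightarrow> (nat \<Rightarrow> real) \<Rightarrow> (nat \<Rightarrow> real)" where
  "majority_map q k x =
     (\<lambda>i. if i = 0 then 1 - (\<Sum>j=1..k. majority_prob q k x j)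
          else if i \<le> k then majority_prob q k x i
          else 0)"

definition geometric_offspring :: "real \<Rightarrow> nat \<Rightarrow> real" where
  "geometric_offspring p n = (if n \<ge> 2 then p * (1 - p) ^ (n - 2) else 0)"

end

theory Submission
  imports Defs
begin

text \<open>
  If \<open>x\<^sub>j \<le> \<rho> x\<^sub>1\<close> with \<open>\<rho> < 1\<close>, exchanging the opinions \<open>1\<close> and \<open>j\<close> in each configuration won
  by \<open>j\<close> shows that one step preserves this inequality, and the configuration with two children of
  the same opinion makes \<open>\<rho>\<close> shrink by a factor bounded away from \<open>1\<close> as long as \<open>x\<^sub>1\<close> is bounded
  below. Such a bound holds because \<open>1 - x\<^sub>0\<close> is increased by the step when it is small: every
  vertex has at least two children. Hence the opinions \<open>3, \<dots>, k\<close> die out, and \<open>x\<^sub>0\<close>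
  asymptotically follows the recursion for \<open>k = 2\<close>. With \<open>r = 1 - p\<close> and
  \<open>v(s) = sqrt (p (1 + r - 2 r s))\<close>, central binomial coefficients turn that recursion into
  \<open>f(s) = p / r\<^sup>2 (1 / v(s) - 1 - r s)\<close>, whose fixed points are \<open>\<alpha>\<close> and \<open>1\<close>. The slope of the chord
  from \<open>\<alpha>\<close> to \<open>s\<close> is \<open>p / r (2 p / (v w (v + w)) - 1)\<close> with \<open>w = v(\<alpha>)\<close>; it is at least \<open>- p\<close>
  since \<open>v, w \<le> 1\<close>, and below \<open>1\<close> uniformly in \<open>s \<le> 1 - \<epsilon>\<close>, so \<open>f\<close> contracts towards \<open>\<alpha>\<close>.
\<close>

section \<open>Multinomial weights of strict majorities\<close>

definition count_vectors :: "nat \<Rightarrow> nat \<Rightarrow> (nat \<Rightarrow> nat) set" where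
  "count_vectors k r = {m. (\<forall>j. j \<notin> {1..k} \<longrightarrow> m j = 0) \<and> (\<Sum>j=1..k. m j) = r}"

text \<open>The total weight of the words of length \<open>r\<close> over the opinions
  \<open>1, ..., k\<close> whose letter counts are \<open>m\<close>. The letters need not have total
  mass 1, since state 0 is treated separately.\<close>

definition word_weight :: "nat \<Rightarrow> (nat \<Rightarrow> real) \<Rightarrow> nat \<Rightarrow> (nat \<Rightarrow> nat) \<Rightarrow> real" where
  "word_weight k x r m = multinomial_coeff k r m * (\<Prod>j=1..k. x j ^ m j)"

lemma word_weight_nonneg:
  assumes "\<And>j. 0 \<le> x j"
  shows "0 \<le> word_weight k x r m"
  unfolding word_weight_def multinomial_coeff_def
  by (intro mult_nonneg_nonneg divide_nonneg_nonneg prod_nonneg) (use assms in auto)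

lemma finite_count_vectors: "finite (count_vectors k r)"
proof -
  have "count_vectors k r \<subseteq> {m. \<forall>j. (j \<in> {1..k} \<longrightarrow> m j \<in> {..r}) \<and> (j \<notin> {1..k} \<longrightarrow> m j = 0)}"
  proof
    fix m assume m: "m \<in> count_vectors k r"
    have "m j \<le> r" if "j \<in> {1..k}" for j
      using m member_le_sum[of j "{1..k}" m] that by (auto simp: count_vectors_def)
    then show "m \<in> {m. \<forall>j. (j \<in> {1..k} \<longrightarrow> m j \<in> {..r}) \<and> (j \<notin> {1..k} \<longrightarrow> m j = 0)}"
      using m by (auto simp: count_vectors_def)
  qed
  moreover have "finite {m. \<forall>j. (j \<in> {1..k} \<longrightarrow> m j \<in> {..r}) \<and> (j \<notin> {1..k} \<longrightarrow> m j = 0)}"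
    by (rule finite_set_of_finite_funs) auto
  ultimately show ?thesis by (rule finite_subset)
qed

text \<open>Induction on the number of opinions. Splitting off the count \<open>a\<close> of the
  last one produces the factor \<open>r choose a\<close>, so the remaining sum over \<open>a\<close>
  is a binomial expansion.\<close>

lemma multinomial_theorem:
  "(\<Sum>m\<in>count_vectors k r. word_weight k x r m) = (\<Sum>j=1..k. x j) ^ r"
proof (induction k arbitrary: r)
  case 0
  have "count_vectors 0 r = (if r = 0 then {\<lambda>_. 0} else {})"
    by (auto simp: count_vectors_def)
  then show ?case by (auto simp: word_weight_def multinomial_coeff_def)
next
  case (Suc k)
  have "(\<Sum>m\<in>count_vectors (Suc k) r. word_weight (Suc k) x r m)
      = (\<Sum>(a, m)\<in>Sigma {..r} (\<lambda>a. count_vectors k (r - a)).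
           real (r choose a) * x (Suc k) ^ a * word_weight k x (r - a) m)"
  \<comment> \<open>The removed coordinate is reset to 0, so that the remaining function again
    vanishes outside \<open>{1..k}\<close> as the encoding of tuples demands.\<close>
  proof (rule sum.reindex_bij_witness[where i = "\<lambda>(a, m). m(Suc k := a)"
        and j = "\<lambda>m. (m (Suc k), m(Suc k := 0))"])
    fix m assume m: "m \<in> count_vectors (Suc k) r"
    have s: "(\<Sum>j=1..k. m j) + m (Suc k) = r" using m by (simp add: count_vectors_def)
    have c: "(\<Sum>j=1..k. (m(Suc k := 0)) j) = (\<Sum>j=1..k. m j)"
      by (intro sum.cong) auto
    show "(case (m (Suc k), m(Suc k := 0)) of (a, m) \<Rightarrow> m(Suc k := a)) = m" by simp
    show "(m (Suc k), m(Suc k := 0)) \<in> Sigma {..r} (\<lambda>a. count_vectors k (r - a))"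
      using m s c by (auto simp: count_vectors_def)
    have p1: "(\<Prod>j=1..k. fact ((m(Suc k := 0)) j)) = (\<Prod>j=1..k. fact (m j) :: real)"
      by (intro prod.cong) auto
    have p2: "(\<Prod>j=1..k. x j ^ (m(Suc k := 0)) j) = (\<Prod>j=1..k. x j ^ m j)"
      by (intro prod.cong) auto
    have "real (r choose m (Suc k)) = fact r / (fact (m (Suc k)) * fact (r - m (Suc k)))"
      by (rule binomial_fact) (use s in linarith)
    then show "(case (m (Suc k), m(Suc k := 0)) of (a, m) \<Rightarrow>
        real (r choose a) * x (Suc k) ^ a * word_weight k x (r - a) m) = word_weight (Suc k) x r m"
      unfolding word_weight_def multinomial_coeff_def prod.case p1 p2
      by (simp add: field_simps)
  next
    fix b assume "b \<in> Sigma {..r} (\<lambda>a. count_vectors k (r - a))"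
    then obtain a m where b: "b = (a, m)" "a \<le> r" "m \<in> count_vectors k (r - a)" by auto
    have m0: "m(Suc k := 0) = m" using b by (auto simp: count_vectors_def)
    show "((case b of (a, m) \<Rightarrow> m(Suc k := a)) (Suc k), (case b of (a, m) \<Rightarrow> m(Suc k := a))(Suc k := 0)) = b"
      using b m0 by simp
    have c: "(\<Sum>j=1..k. (m(Suc k := a)) j) = (\<Sum>j=1..k. m j)"
      by (intro sum.cong) auto
    show "(case b of (a, m) \<Rightarrow> m(Suc k := a)) \<in> count_vectors (Suc k) r"
      using b c by (auto simp: count_vectors_def)
  qed
  also have "\<dots> = (\<Sum>a\<le>r. \<Sum>m\<in>count_vectors k (r - a).
           real (r choose a) * x (Suc k) ^ a * word_weight k x (r - a) m)"
    by (subst sum.Sigma) (auto simp: finite_count_vectors)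
  also have "\<dots> = (\<Sum>a\<le>r. real (r choose a) * x (Suc k) ^ a * (\<Sum>j=1..k. x j) ^ (r - a))"
    by (simp add: sum_distrib_left[symmetric] Suc.IH)
  also have "\<dots> = (x (Suc k) + (\<Sum>j=1..k. x j)) ^ r"
    by (simp add: binomial_ring)
  finally show ?case by (simp add: add.commute)
qed

definition majority_weight :: "nat \<Rightarrow> (nat \<Rightarrow> real) \<Rightarrow> nat \<Rightarrow> nat \<Rightarrow> real" where
  "majority_weight k x i r = (\<Sum>m\<in>majority_counts k i r. word_weight k x r m)"

lemma majority_counts_subset: "majority_counts k i r \<subseteq> count_vectors k r"
  by (auto simp: majority_counts_def count_vectors_def)

lemma finite_majority_counts: "finite (majority_counts k i r)"
  by (rule finite_subset[OF majority_counts_subset finite_count_vectors])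

lemma majority_weight_nonneg:
  assumes "\<And>j. 0 \<le> x j"
  shows "0 \<le> majority_weight k x i r"
  unfolding majority_weight_def by (intro sum_nonneg word_weight_nonneg assms)

lemma disjoint_majority_counts:
  assumes "i \<in> {1..k}" "j \<in> {1..k}" "i \<noteq> j"
  shows "majority_counts k i r \<inter> majority_counts k j s = {}"
  using assms by (fastforce simp: majority_counts_def)

section \<open>Configurations that use only the opinions 1 and 2\<close>

definition pair_vector :: "nat \<Rightarrow> nat \<Rightarrow> (nat \<Rightarrow> nat)" where
  "pair_vector a b = (\<lambda>j. if j = 1 then a else if j = 2 then b else 0)"

lemma pair_vector_eq_iff: "pair_vector a b = pair_vector c d \<longleftrightarrow> a = c \<and> b = d"
proof
  assume "pair_vector a b = pair_vector c d"
  from fun_cong[OF this, of 1] fun_cong[OF this, of 2] show "a = c \<and> b = d"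
    by (simp add: pair_vector_def)
qed simp

lemma atLeastAtMost_split_2: "(2::nat) \<le> k \<Longrightarrow> {1..k} = insert 1 (insert 2 {3..k})"
  by auto

lemma sum_split_2:
  assumes "2 \<le> (k::nat)"
  shows "(\<Sum>j=1..k. f j) = f 1 + f 2 + (\<Sum>j=3..k. f j :: 'a :: comm_monoid_add)"
  unfolding atLeastAtMost_split_2[OF assms] by (simp add: add.assoc)

lemma prod_split_2:
  assumes "2 \<le> (k::nat)"
  shows "(\<Prod>j=1..k. f j) = f 1 * f 2 * (\<Prod>j=3..k. f j :: 'a :: comm_monoid_mult)"
  unfolding atLeastAtMost_split_2[OF assms] by (simp add: mult.assoc)

lemma pair_vector_count:
  assumes "2 \<le> k"
  shows "pair_vector a b \<in> count_vectors k (a + b)"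
proof -
  have "(\<Sum>j=3..k. pair_vector a b j) = 0" by (rule sum.neutral) (auto simp: pair_vector_def)
  then show ?thesis
    using assms unfolding count_vectors_def mem_Collect_eq sum_split_2[OF assms]
    by (auto simp: pair_vector_def)
qed

lemma word_weight_pair_vector:
  assumes "2 \<le> k"
  shows "word_weight k x (a + b) (pair_vector a b) = real (a + b choose a) * x 1 ^ a * x 2 ^ b"
proof -
  have "(\<Prod>j=3..k. fact (pair_vector a b j)) = (1::real)"
    by (rule prod.neutral) (auto simp: pair_vector_def)
  moreover have "(\<Prod>j=3..k. x j ^ pair_vector a b j) = 1"
    by (rule prod.neutral) (auto simp: pair_vector_def)
  moreover have "real (a + b choose a) = fact (a + b) / (fact a * fact b)"
    by (simp add: binomial_fact)
  ultimately show ?thesis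
    unfolding word_weight_def multinomial_coeff_def prod_split_2[OF assms]
    by (simp add: pair_vector_def)
qed

text \<open>The weight of the configuration \<open>m\<^sub>1 = m\<^sub>2 = r / 2\<close>; it vanishes for odd \<open>r\<close>, when the
  index set is empty.\<close>

definition tie_weight :: "real \<Rightarrow> nat \<Rightarrow> real" where
  "tie_weight y r = (\<Sum>a\<in>{a. 2 * a = r}. real (r choose a) * y ^ r)"

lemma tie_weight_even: "tie_weight y (2 * a) = real (2 * a choose a) * y ^ (2 * a)"
  by (simp add: tie_weight_def)

lemma tie_weight_odd: "odd r \<Longrightarrow> tie_weight y r = 0"
proof -
  assume "odd r"
  then have "{a. 2 * a = r} = {}" by auto
  then show ?thesis by (simp only: tie_weight_def sum.empty)
qed

lemma finite_double_eq: "finite {a::nat. 2 * a = r}"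
  by (rule finite_subset[of _ "{..r}"]) auto

lemma tie_weight_nonneg: "0 \<le> y \<Longrightarrow> 0 \<le> tie_weight y r"
  by (auto simp: tie_weight_def intro!: sum_nonneg)

text \<open>Counts won by different opinions are disjoint, and in a tie of 1 and 2 neither beats the
  other, so nobody wins. All these counts are therefore distinct terms of one multinomial
  expansion.\<close>

lemma majority_weight_sum_le:
  assumes "2 \<le> k" "\<And>j. 0 \<le> x j" "x 1 = y" "x 2 = y"
  shows "(\<Sum>i=1..k. majority_weight k x i r) + tie_weight y r \<le> (\<Sum>j=1..k. x j) ^ r"
proof -
  let ?M = "\<Union>i\<in>{1..k}. majority_counts k i r"
  let ?T = "(\<lambda>a. pair_vector a a) ` {a. 2 * a = r}"
  have "(\<Sum>i=1..k. majority_weight k x i r) = (\<Sum>m\<in>?M. word_weight k x r m)"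
    unfolding majority_weight_def
    by (rule sum.UNION_disjoint[symmetric])
      (use disjoint_majority_counts in \<open>simp_all add: finite_majority_counts\<close>)
  moreover have "tie_weight y r = (\<Sum>m\<in>?T. word_weight k x r m)"
  proof -
    have inj: "inj_on (\<lambda>a. pair_vector a a) {a. 2 * a = r}"
      by (simp add: inj_on_def pair_vector_eq_iff)
    show ?thesis
      unfolding sum.reindex[OF inj] tie_weight_def
    proof (rule sum.cong[OF refl])
      fix a assume "a \<in> {a. 2 * a = r}"
      then have r: "r = a + a" by auto
      show "real (r choose a) * y ^ r = (word_weight k x r \<circ> (\<lambda>a. pair_vector a a)) a"
        unfolding r o_def word_weight_pair_vector[OF assms(1)] using assms(3,4)
        by (simp add: power_add)
    qed
  qed
  moreover have "?M \<inter> ?T = {}"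
  proof -
    have "pair_vector a a \<notin> majority_counts k i r" if "i \<in> {1..k}" for a i
    proof
      assume *: "pair_vector a a \<in> majority_counts k i r"
      have "1 \<in> {1..k}" "2 \<in> {1..k}" using assms(1) by auto
      then have "1 \<noteq> i \<longrightarrow> pair_vector a a 1 < pair_vector a a i"
        "2 \<noteq> i \<longrightarrow> pair_vector a a 2 < pair_vector a a i"
        using * unfolding majority_counts_def by blast+
      then show False by (auto simp: pair_vector_def split: if_splits)
    qed
    then show ?thesis by auto
  qed
  moreover have "finite ?M" "finite ?T" by (auto simp: finite_majority_counts finite_double_eq)
  ultimately have "(\<Sum>i=1..k. majority_weight k x i r) + tie_weight y r
      = (\<Sum>m\<in>?M \<union> ?T. word_weight k x r m)"
    by (simp add: sum.union_disjoint)
  also have "\<dots> \<le> (\<Sum>m\<in>count_vectors k r. word_weight k x r m)"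
  proof (rule sum_mono2[OF finite_count_vectors])
    show "?M \<union> ?T \<subseteq> count_vectors k r"
    proof (intro Un_least UN_least majority_counts_subset image_subsetI)
      fix a assume "a \<in> {a. 2 * a = r}"
      then have "a + a = r" by simp
      then show "pair_vector a a \<in> count_vectors k r"
        using pair_vector_count[OF assms(1), of a a] by simp
    qed
  qed (use assms in \<open>auto intro: word_weight_nonneg\<close>)
  finally show ?thesis by (simp add: multinomial_theorem)
qed

text \<open>In the expansion of \<open>(y + y) ^ r\<close> every term with unequal exponents is a
  configuration without minor opinions, won by 1 or by 2. Together with the preceding upper bound
  this confines the step up to the mass of the opinions \<open>3, ..., k\<close>.\<close>

lemma majority_weight_pair_ge:
  assumes "2 \<le> k" "\<And>j. 0 \<le> x j" "x 1 = y" "x 2 = y"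
  shows "(2 * y) ^ r - tie_weight y r \<le> majority_weight k x 1 r + majority_weight k x 2 r"
proof -
  let ?P = "{a. a \<le> r \<and> 2 * a \<noteq> r}"
  let ?f = "\<lambda>a. pair_vector a (r - a)"
  have "(2 * y) ^ r = (\<Sum>a\<le>r. real (r choose a) * y ^ r)"
  proof -
    have "(2 * y) ^ r = (y + y) ^ r" by simp
    also have "\<dots> = (\<Sum>a\<le>r. real (r choose a) * y ^ a * y ^ (r - a))" by (rule binomial_ring)
    also have "\<dots> = (\<Sum>a\<le>r. real (r choose a) * y ^ r)"
      by (intro sum.cong) (auto simp: mult.assoc simp flip: power_add)
    finally show ?thesis .
  qed
  also have "\<dots> = (\<Sum>a\<in>?P. real (r choose a) * y ^ r) + tie_weight y r"
    unfolding tie_weight_def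
    by (subst sum.union_disjoint[symmetric]) (auto simp: finite_double_eq intro!: sum.cong)
  finally have "(2 * y) ^ r - tie_weight y r = (\<Sum>a\<in>?P. real (r choose a) * y ^ r)" by simp
  also have "\<dots> = (\<Sum>m\<in>?f ` ?P. word_weight k x r m)"
  proof -
    have inj: "inj_on ?f ?P"
      by (simp add: inj_on_def pair_vector_eq_iff)
    show ?thesis
      unfolding sum.reindex[OF inj]
    proof (rule sum.cong[OF refl])
      fix a assume "a \<in> ?P"
      then have "a + (r - a) = r" by auto
      then show "real (r choose a) * y ^ r = (word_weight k x r \<circ> ?f) a"
        unfolding o_def using word_weight_pair_vector[OF assms(1), of x a "r - a"] assms(3,4)
        by (simp add: mult.assoc flip: power_add)
    qed
  qed
  also have "\<dots> \<le> (\<Sum>m\<in>majority_counts k 1 r \<union> majority_counts k 2 r. word_weight k x r m)"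
  proof (rule sum_mono2)
    show "?f ` ?P \<subseteq> majority_counts k 1 r \<union> majority_counts k 2 r"
    proof
      fix m assume "m \<in> ?f ` ?P"
      then obtain a where a: "a \<le> r" "2 * a \<noteq> r" "m = ?f a" by auto
      then have "m \<in> count_vectors k r" using pair_vector_count[OF assms(1), of a "r - a"] by simp
      moreover have "(\<forall>j\<in>{1..k}. j \<noteq> 1 \<longrightarrow> m j < m 1) \<or> (\<forall>j\<in>{1..k}. j \<noteq> 2 \<longrightarrow> m j < m 2)"
        using a by (cases "2 * a < r") (auto simp: pair_vector_def)
      ultimately show "m \<in> majority_counts k 1 r \<union> majority_counts k 2 r"
        by (auto simp: count_vectors_def majority_counts_def)
    qed
  qed (use assms in \<open>auto intro: word_weight_nonneg simp: finite_majority_counts\<close>)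
  also have "\<dots> = majority_weight k x 1 r + majority_weight k x 2 r"
    unfolding majority_weight_def
    by (rule sum.union_disjoint)
      (use assms(1) disjoint_majority_counts[of 1 k 2] in \<open>simp_all add: finite_majority_counts\<close>)
  finally show ?thesis .
qed

text \<open>Transposing \<open>i\<close> and \<open>j\<close> maps the counts won by \<open>i\<close> to those won by \<open>j\<close> and multiplies
  their weight by \<open>(x\<^sub>j / x\<^sub>i)\<close> to the power \<open>m\<^sub>i - m\<^sub>j \<ge> 1\<close>.\<close>

lemma majority_weight_ratio:
  assumes i: "i \<in> {1..k}" and j: "j \<in> {1..k}" and "i \<noteq> j" and nn: "\<And>l. 0 \<le> x l"
    and \<rho>: "0 \<le> \<rho>" "\<rho> \<le> 1" and le: "x j \<le> \<rho> * x i"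
  shows "majority_weight k x j r \<le> \<rho> * majority_weight k x i r"
proof -
  let ?t = "Transposition.transpose i j"
  have t: "bij_betw ?t {1..k} {1..k}"
    using i j by (auto simp: bij_betw_transpose_iff Transposition.transpose_def)
  have cv: "(\<Sum>l=1..k. (m \<circ> ?t) l) = (\<Sum>l=1..k. m l)" for m :: "nat \<Rightarrow> nat"
    unfolding o_def by (rule sum.reindex_bij_betw[OF t])
  have swap: "m \<circ> ?t \<in> majority_counts k (?t a) r"
    if m: "m \<in> majority_counts k a r" for m a
  proof -
    have out: "?t l = l" if "l \<notin> {1..k}" for l
      using that i j by (auto simp: Transposition.transpose_def)
    have "m (?t l) < m (?t (?t a))" if "l \<in> {1..k}" "l \<noteq> ?t a" for l
    proof -
      have "?t l \<in> {1..k}" using bij_betwE[OF t] that(1) by blast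
      moreover have "?t l \<noteq> a" using that(2) by auto
      ultimately show ?thesis using m by (simp add: majority_counts_def)
    qed
    then show ?thesis
      using m cv[of m] out by (simp add: majority_counts_def)
  qed
  have "majority_weight k x j r = (\<Sum>m\<in>majority_counts k i r. word_weight k x r (m \<circ> ?t))"
    unfolding majority_weight_def
  proof (rule sum.reindex_bij_witness[where i = "\<lambda>m. m \<circ> ?t" and j = "\<lambda>m. m \<circ> ?t"])
    fix m assume "m \<in> majority_counts k j r"
    then show "m \<circ> ?t \<in> majority_counts k i r"
      using swap[of m j] by simp
  next
    fix m assume "m \<in> majority_counts k i r"
    then show "m \<circ> ?t \<in> majority_counts k j r"
      using swap[of m i] by simp
  qed (auto simp: o_assoc[symmetric])
  also have "\<dots> \<le> (\<Sum>m\<in>majority_counts k i r. \<rho> * word_weight k x r m)"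
  proof (rule sum_mono)
    fix m assume m: "m \<in> majority_counts k i r"
    have lt: "m j < m i" using m j \<open>i \<noteq> j\<close> by (auto simp: majority_counts_def)
    let ?R = "\<Prod>l\<in>{1..k} - {i, j}. x l ^ m l"
    have R: "0 \<le> ?R" by (intro prod_nonneg) (use nn in auto)
    have split: "(\<Prod>l=1..k. x l ^ f l) = x i ^ f i * x j ^ f j * (\<Prod>l\<in>{1..k} - {i, j}. x l ^ f l)"
      for f :: "nat \<Rightarrow> nat"
    proof -
      have "{1..k} = insert i (insert j ({1..k} - {i, j}))" using i j by auto
      then have "(\<Prod>l=1..k. x l ^ f l) = (\<Prod>l\<in>insert i (insert j ({1..k} - {i, j})). x l ^ f l)"
        by simp
      also have "\<dots> = x i ^ f i * x j ^ f j * (\<Prod>l\<in>{1..k} - {i, j}. x l ^ f l)"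
        using \<open>i \<noteq> j\<close> by (simp add: mult.assoc)
      finally show ?thesis .
    qed
    have rest: "(\<Prod>l\<in>{1..k} - {i, j}. x l ^ (m \<circ> ?t) l) = ?R"
      by (intro prod.cong) (auto simp: Transposition.transpose_def)
    \<comment> \<open>Only one factor \<rho> out of \<open>\<rho> ^ Suc d\<close> is kept. Comparing
      powers instead of dividing by \<open>x i\<close> also covers \<open>x i = 0\<close>.\<close>
    obtain d where d: "m i = m j + Suc d" using lt less_iff_Suc_add by auto
    have "x j ^ Suc d \<le> (\<rho> * x i) ^ Suc d" by (rule power_mono[OF le nn])
    also have "\<dots> = \<rho> * \<rho> ^ d * x i ^ Suc d" by (simp add: power_mult_distrib)
    also have "\<dots> \<le> \<rho> * x i ^ Suc d"
      by (intro mult_right_mono) (use \<rho> nn in \<open>auto intro: mult_left_le power_le_one\<close>)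
    finally have pw: "x j ^ Suc d \<le> \<rho> * x i ^ Suc d" .
    have "x i ^ m j * x j ^ m i = (x i ^ m j * x j ^ m j) * x j ^ Suc d"
      by (simp add: d power_add)
    also have "\<dots> \<le> (x i ^ m j * x j ^ m j) * (\<rho> * x i ^ Suc d)"
      by (intro mult_left_mono pw) (use nn in auto)
    also have "\<dots> = \<rho> * (x i ^ m i * x j ^ m j)" by (simp add: d power_add)
    finally have key: "x i ^ m j * x j ^ m i \<le> \<rho> * (x i ^ m i * x j ^ m j)" .
    have prods: "(\<Prod>l=1..k. x l ^ (m \<circ> ?t) l) \<le> \<rho> * (\<Prod>l=1..k. x l ^ m l)"
      unfolding split rest using mult_right_mono[OF key R] by (simp add: mult.assoc)
    have "(\<Prod>l=1..k. fact ((m \<circ> ?t) l) :: real) = (\<Prod>l=1..k. fact (m l))"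
      unfolding o_def by (rule prod.reindex_bij_betw[OF t])
    then have "multinomial_coeff k r (m \<circ> ?t) = multinomial_coeff k r m"
      by (simp add: multinomial_coeff_def)
    moreover have "0 \<le> multinomial_coeff k r m"
      by (auto simp: multinomial_coeff_def intro!: divide_nonneg_nonneg prod_nonneg)
    ultimately show "word_weight k x r (m \<circ> ?t) \<le> \<rho> * word_weight k x r m"
      unfolding word_weight_def using mult_left_mono[OF prods, of "multinomial_coeff k r m"]
      by (simp add: mult.left_commute)
  qed
  finally show ?thesis by (simp add: majority_weight_def sum_distrib_left)
qed

section \<open>One or two decided children\<close>

lemma word_weight_single:
  assumes "i \<in> {1..k}"
  shows "word_weight k x r ((\<lambda>_. 0)(i := r)) = x i ^ r"
proof -
  have "(\<Prod>j=1..k. fact (((\<lambda>_. 0)(i := r)) j)) = (\<Prod>j=1..k. if j = i then fact r else (1::real))"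
    by (intro prod.cong) auto
  moreover have "(\<Prod>j=1..k. x j ^ ((\<lambda>_. 0)(i := r)) j) = (\<Prod>j=1..k. if j = i then x i ^ r else 1)"
    by (intro prod.cong) auto
  ultimately show ?thesis
    using assms by (simp add: word_weight_def multinomial_coeff_def prod.delta)
qed

text \<open>With at most two votes, a loser holding one vote would force the winner to hold two,
  hence three votes in total. So the winner takes all.\<close>

lemma majority_counts_small:
  assumes "i \<in> {1..k}" "r = 1 \<or> r = 2"
  shows "majority_counts k i r = {(\<lambda>_. 0)(i := r)}"
proof
  have s: "(\<Sum>j=1..k. m j) = m i + (\<Sum>j\<in>{1..k} - {i}. m j)" for m :: "nat \<Rightarrow> nat"
    using assms(1) by (simp add: sum.remove)
  have "(\<Sum>j=1..k. ((\<lambda>_. 0)(i := r)) j) = r"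
    unfolding s[of "(\<lambda>_. 0)(i := r)"] by simp
  then show "{(\<lambda>_. 0)(i := r)} \<subseteq> majority_counts k i r"
    using assms by (auto simp: majority_counts_def)
  show "majority_counts k i r \<subseteq> {(\<lambda>_. 0)(i := r)}"
  proof
    fix m assume m: "m \<in> majority_counts k i r"
    have z: "m j = 0" if "j \<noteq> i" for j
    proof (cases "j \<in> {1..k}")
      case True
      have "m j \<le> (\<Sum>j\<in>{1..k} - {i}. m j)"
        by (rule member_le_sum) (use True that in auto)
      moreover have "(\<Sum>j=1..k. m j) = r" using m by (simp add: majority_counts_def)
      ultimately have "m i + m j \<le> r" using s[of m] by linarith
      moreover have "m j < m i" using m True that by (auto simp: majority_counts_def)
      ultimately show ?thesis using assms(2) by auto
    qed (use m in \<open>auto simp: majority_counts_def\<close>)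
    then have "(\<Sum>j\<in>{1..k} - {i}. m j) = 0" by (intro sum.neutral) auto
    then have "m i = r" using m s[of m] by (simp add: majority_counts_def)
    with z show "m \<in> {(\<lambda>_. 0)(i := r)}" by (simp add: fun_eq_iff)
  qed
qed

lemma majority_weight_small:
  assumes "i \<in> {1..k}" "r = 1 \<or> r = 2"
  shows "majority_weight k x i r = x i ^ r"
  unfolding majority_weight_def majority_counts_small[OF assms]
  by (simp add: word_weight_single[OF assms(1)] del: fun_upd_apply)

section \<open>Generating function of the ties\<close>

text \<open>The binomial series with exponent \<open>- (l + 1)\<close> at \<open>- z\<close>; the
  signs cancel. It serves to sum over the number \<open>m\<close> of undecided children when
  \<open>l\<close> children are decided.\<close>

lemma negative_binomial_has_sum:
  fixes z :: real
  assumes "0 \<le> z" "z < 1"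
  shows "((\<lambda>m. real (l + m choose m) * z ^ m) has_sum (1 / (1 - z) ^ Suc l)) UNIV"
proof (rule sums_nonneg_imp_has_sum)
  have "(\<lambda>n. (- real (Suc l) gchoose n) * (- z) ^ n) sums (1 + - z) powr (- real (Suc l))"
    by (rule gen_binomial_real) (use assms in auto)
  moreover have "(- real (Suc l) gchoose n) * (- z) ^ n = real (l + n choose n) * z ^ n" for n
  proof -
    have "(- real (Suc l) gchoose n) = (- 1) ^ n * (real (Suc l) + real n - 1 gchoose n)"
      by (rule gbinomial_minus)
    also have "real (Suc l) + real n - 1 = real (l + n)" by simp
    finally show ?thesis
      by (simp add: binomial_gbinomial power_minus[of z] mult.assoc mult.left_commute)
  qed
  moreover have "(1 + - z) powr (- real (Suc l)) = 1 / (1 - z) ^ Suc l"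
    using assms powr_realpow[of "1 - z" "Suc l"]
    by (simp only: powr_minus) (simp add: divide_inverse)
  ultimately show "(\<lambda>m. real (l + m choose m) * z ^ m) sums (1 / (1 - z) ^ Suc l)" by simp
qed (use assms in auto)

text \<open>Absorption is applied twice, with the symmetry of row \<open>2 * m + 1\<close> in
  between. This recursion identifies the coefficients of the binomial series with exponent
  \<open>- 1 / 2\<close>.\<close>

lemma central_binomial_Suc:
  "real (Suc m) * real (2 * Suc m choose Suc m) = 2 * real (2 * m + 1) * real (2 * m choose m)"
proof -
  have 1: "Suc m * (Suc (2 * m + 1) choose Suc m) = Suc (2 * m + 1) * (2 * m + 1 choose m)"
    by (rule Suc_times_binomial)
  have 2: "Suc m * (Suc (2 * m) choose Suc m) = Suc (2 * m) * (2 * m choose m)"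
    by (rule Suc_times_binomial)
  have 3: "(2 * m + 1 choose m) = (Suc (2 * m) choose Suc m)"
    using binomial_symmetric[of m "2 * m + 1"] by simp
  have "Suc m * (Suc (2 * m + 1) choose Suc m) = 2 * (Suc (2 * m) * (2 * m choose m))"
    unfolding 1 3 2[symmetric] by simp
  then have "Suc m * (2 * Suc m choose Suc m) = 2 * (2 * m + 1) * (2 * m choose m)" by simp
  then have "real (Suc m * (2 * Suc m choose Suc m)) = real (2 * (2 * m + 1) * (2 * m choose m))"
    by (rule arg_cong)
  then show ?thesis by (simp only: of_nat_mult of_nat_numeral)
qed

lemma gbinomial_minus_half:
  "((- 1 / 2 :: real) gchoose m) * (- 4) ^ m = real (2 * m choose m)"
proof (induction m)
  case (Suc m)
  let ?g = "(- 1 / 2 :: real) gchoose m"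
  have "real (Suc m) * ((- 1 / 2) gchoose Suc m) = (- 1 / 2 - real m) * ?g"
    using gbinomial_mult_1'[of "- 1 / 2 :: real" m] by (simp add: algebra_simps)
  note rec = this
  have "real (Suc m) * (((- 1 / 2) gchoose Suc m) * (- 4) ^ Suc m)
      = (real (Suc m) * ((- 1 / 2) gchoose Suc m)) * ((- 4) * (- 4) ^ m)"
    by (simp only: power_Suc mult.assoc)
  also have "\<dots> = (- 1 / 2 - real m) * (- 4) * (?g * (- 4) ^ m)"
    unfolding rec by (simp only: mult_ac)
  also have "\<dots> = real (Suc m) * real (2 * Suc m choose Suc m)"
    unfolding Suc central_binomial_Suc by (simp add: algebra_simps)
  finally show ?case by (simp only: mult_left_cancel)
qed simp

lemma central_binomial_sums:
  fixes z :: real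
  assumes "0 \<le> z" "z < 1 / 4"
  shows "(\<lambda>m. real (2 * m choose m) * z ^ m) sums (1 / sqrt (1 - 4 * z))"
proof -
  have "(\<lambda>m. ((- 1 / 2) gchoose m) * (- 4 * z) ^ m) sums (1 + - 4 * z) powr (- 1 / 2)"
  proof (rule gen_binomial_real)
    show "\<bar>- 4 * z\<bar> < 1" using assms by (simp only: abs_mult)
  qed
  moreover have "((- 1 / 2) gchoose m) * (- 4 * z) ^ m = real (2 * m choose m) * z ^ m" for m
  proof -
    have "((- 1 / 2) gchoose m) * (- 4 * z) ^ m = (((- 1 / 2) gchoose m) * (- 4) ^ m) * z ^ m"
      unfolding power_mult_distrib by (rule mult.assoc[symmetric])
    then show ?thesis unfolding gbinomial_minus_half .
  qed
  moreover have "(1 + - 4 * z) powr (- 1 / 2) = 1 / sqrt (1 - 4 * z)"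
  proof -
    have "(1 + - 4 * z) powr (- 1 / 2) = (1 - 4 * z) powr - (1 / 2)" by simp
    also have "\<dots> = inverse (sqrt (1 - 4 * z))"
      using assms by (simp only: powr_minus powr_half_sqrt)
    finally show ?thesis by (simp only: inverse_eq_divide)
  qed
  ultimately show ?thesis by simp
qed

text \<open>Only even indices contribute, and there the series is that of the central binomial
  coefficients at \<open>(z * y)\<close> squared.\<close>

lemma tie_weight_has_sum:
  fixes z y :: real
  assumes "0 \<le> z" "0 \<le> y" "2 * z * y < 1"
  shows "((\<lambda>l. z ^ l * tie_weight y l) has_sum (1 / sqrt (1 - 4 * (z * y)\<^sup>2))) UNIV"
proof -
  have "(2 * z * y)\<^sup>2 < 1" using assms by (simp add: abs_square_less_1)
  then have sm: "(z * y)\<^sup>2 < 1 / 4" by (simp add: power_mult_distrib)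
  have "((\<lambda>m. real (2 * m choose m) * ((z * y)\<^sup>2) ^ m) has_sum (1 / sqrt (1 - 4 * (z * y)\<^sup>2))) UNIV"
    by (rule sums_nonneg_imp_has_sum[OF central_binomial_sums]) (use sm in auto)
  also have "(\<lambda>m. real (2 * m choose m) * ((z * y)\<^sup>2) ^ m)
      = (\<lambda>l. z ^ l * tie_weight y l) \<circ> (\<lambda>m. 2 * m)"
    by (simp add: fun_eq_iff tie_weight_even power_mult_distrib flip: power_mult)
  finally have "((\<lambda>l. z ^ l * tie_weight y l) has_sum (1 / sqrt (1 - 4 * (z * y)\<^sup>2))) (range ((*) 2))"
    by (subst has_sum_reindex) (simp_all add: inj_on_def o_def)
  then show ?thesis
  proof (rule has_sum_cong_neutral[THEN iffD1, rotated -1])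
    fix l :: nat assume "l \<in> UNIV - range ((*) 2)"
    then have "odd l" unfolding dvd_def by blast
    then show "z ^ l * tie_weight y l = 0" by (simp add: tie_weight_odd)
  qed simp_all
qed

text \<open>With \<open>s\<close> the mass of state 0 and \<open>y\<close> that of each of the
  opinions 1 and 2, this is the probability that among \<open>n\<close> children the decided ones
  split evenly between 1 and 2. The term \<open>a = n\<close>, all children undecided, is
  included.\<close>

definition tie_branch :: "real \<Rightarrow> real \<Rightarrow> nat \<Rightarrow> real" where
  "tie_branch s y n = (\<Sum>a\<le>n. real (n choose a) * s ^ a * tie_weight y (n - a))"

lemma tie_branch_nonneg: "0 \<le> s \<Longrightarrow> 0 \<le> y \<Longrightarrow> 0 \<le> tie_branch s y n"
  unfolding tie_branch_def by (intro sum_nonneg mult_nonneg_nonneg tie_weight_nonneg) auto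

text \<open>Put \<open>n = l + a\<close> and sum first over the number \<open>a\<close> of undecided
  children by the negative binomial series, then over the number \<open>l\<close> of decided ones.
  All terms are nonnegative, so convergence of the iterated sum justifies the rearrangement.\<close>

lemma tie_branch_has_sum:
  fixes r s y :: real
  assumes r: "0 \<le> r" and s: "0 \<le> s" and y: "0 \<le> y" and lt: "r * (s + 2 * y) < 1"
  shows "((\<lambda>n. r ^ n * tie_branch s y n) has_sum (1 / sqrt ((1 - r * s)\<^sup>2 - 4 * (r * y)\<^sup>2))) UNIV"
proof -
  define f where "f = (\<lambda>(l, a). r ^ (l + a) * real (l + a choose a) * s ^ a * tie_weight y l)"
  define g where "g = (\<lambda>l. r ^ l * tie_weight y l / (1 - r * s) ^ Suc l)"
  have "r * s \<le> r * (s + 2 * y)" by (intro mult_left_mono) (use r y in auto)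
  with lt r s have rs: "0 \<le> r * s" "r * s < 1" by simp_all
  have inner: "((\<lambda>a. f (l, a)) has_sum g l) UNIV" for l
  proof -
    have "((\<lambda>a. r ^ l * tie_weight y l * (real (l + a choose a) * (r * s) ^ a))
        has_sum r ^ l * tie_weight y l * (1 / (1 - r * s) ^ Suc l)) UNIV"
      by (intro has_sum_cmult_right negative_binomial_has_sum rs)
    then show ?thesis
      by (simp add: f_def g_def power_add power_mult_distrib mult_ac)
  qed
  have outer: "(g has_sum (1 / sqrt ((1 - r * s)\<^sup>2 - 4 * (r * y)\<^sup>2))) UNIV"
  proof -
    \<comment> \<open>The inner sum contributes \<open>1 / (1 - r * s) ^ Suc l\<close>; its
      \<open>l\<close>-th power turns \<open>r\<close> into \<open>z\<close>, and one factor is left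
      in front.\<close>
    define z where "z = r / (1 - r * s)"
    have "2 * z * y < 1"
      using rs lt by (simp add: z_def divide_less_eq distrib_left mult_ac)
    moreover have "0 \<le> z" using rs r by (simp add: z_def)
    ultimately have "((\<lambda>l. z ^ l * tie_weight y l) has_sum (1 / sqrt (1 - 4 * (z * y)\<^sup>2))) UNIV"
      using y by (intro tie_weight_has_sum)
    then have "((\<lambda>l. 1 / (1 - r * s) * (z ^ l * tie_weight y l))
        has_sum (1 / (1 - r * s) * (1 / sqrt (1 - 4 * (z * y)\<^sup>2)))) UNIV"
      by (rule has_sum_cmult_right)
    also have "(\<lambda>l. 1 / (1 - r * s) * (z ^ l * tie_weight y l)) = g"
      by (simp add: fun_eq_iff g_def z_def power_divide)
    also have "1 / (1 - r * s) * (1 / sqrt (1 - 4 * (z * y)\<^sup>2))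
        = 1 / (sqrt ((1 - r * s)\<^sup>2) * sqrt (1 - 4 * (z * y)\<^sup>2))"
      using rs by simp
    also have "\<dots> = 1 / sqrt ((1 - r * s)\<^sup>2 * (1 - 4 * (z * y)\<^sup>2))"
      by (simp add: real_sqrt_mult)
    also have "(1 - r * s)\<^sup>2 * (1 - 4 * (z * y)\<^sup>2) = (1 - r * s)\<^sup>2 - 4 * (r * y)\<^sup>2"
      using rs by (simp add: z_def power_divide power_mult_distrib right_diff_distrib)
    finally show ?thesis .
  qed
  have "f summable_on UNIV \<times> UNIV"
    by (rule summable_on_SigmaI[OF inner])
      (use outer r s y in \<open>auto simp: f_def summable_on_def intro!: mult_nonneg_nonneg tie_weight_nonneg\<close>)
  with inner outer have "(f has_sum (1 / sqrt ((1 - r * s)\<^sup>2 - 4 * (r * y)\<^sup>2))) (UNIV \<times> UNIV)"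
    by (intro has_sum_SigmaI)
  then have "((\<lambda>(n, a). r ^ n * (real (n choose a) * s ^ a * tie_weight y (n - a)))
      has_sum (1 / sqrt ((1 - r * s)\<^sup>2 - 4 * (r * y)\<^sup>2))) (SIGMA n:UNIV. {..n})"
    by (rule has_sum_reindex_bij_witness[where i = "\<lambda>(n, a). (n - a, a)"
          and j = "\<lambda>(l, a). (l + a, a)", THEN iffD1, rotated -1])
      (auto simp: f_def)
  then show ?thesis
  proof (rule has_sum_SigmaD)
    fix n
    show "((\<lambda>a. case (n, a) of (n, a) \<Rightarrow> r ^ n * (real (n choose a) * s ^ a * tie_weight y (n - a)))
        has_sum r ^ n * tie_branch s y n) {..n}"
      by (rule has_sum_finiteI) (simp_all add: tie_branch_def sum_distrib_left)
  qed
qed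

section \<open>Averages over the geometric offspring law\<close>

lemma geometric_offspring_nonneg: "0 < p \<Longrightarrow> p < 1 \<Longrightarrow> 0 \<le> geometric_offspring p n"
  by (simp add: geometric_offspring_def)

text \<open>The exponent \<open>n - 1\<close> is that of a family with a single decided child. One
  more factor \<open>z\<close> gives the probability generating function, and \<open>z = 1\<close>
  gives the total mass.\<close>

lemma geometric_offspring_has_sum:
  assumes "0 < p" "p < 1" "0 \<le> z" "z \<le> 1"
  shows "((\<lambda>n. geometric_offspring p n * z ^ (n - 1)) has_sum (p * z / (1 - (1 - p) * z))) {2..}"
proof -
  have "(1 - p) * z \<le> (1 - p) * 1" by (intro mult_left_mono) (use assms in auto)
  then have "(1 - p) * z < 1" by (rule le_less_trans) (use assms in simp)
  then have "\<bar>(1 - p) * z\<bar> < 1" using assms by simp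
  then have "(\<lambda>m. ((1 - p) * z) ^ m) sums (1 / (1 - (1 - p) * z))"
    by (intro geometric_sums) auto
  then have "((\<lambda>m. ((1 - p) * z) ^ m) has_sum (1 / (1 - (1 - p) * z))) UNIV"
    by (rule sums_nonneg_imp_has_sum) (use assms in auto)
  then have "((\<lambda>m. p * z * ((1 - p) * z) ^ m) has_sum (p * z * (1 / (1 - (1 - p) * z)))) UNIV"
    by (rule has_sum_cmult_right)
  then show ?thesis
    by (rule has_sum_reindex_bij_witness[where i = "\<lambda>n. n - 2" and j = "\<lambda>m. m + 2",
          THEN iffD1, rotated -1])
      (auto simp: geometric_offspring_def power_mult_distrib)
qed

text \<open>The mean of \<open>tie_branch s y\<close> over the offspring law. The subtracted
  \<open>1 + (1 - p) * s\<close> are the terms for 0 and 1 children, which the law excludes. At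
  \<open>y = (1 - s) / 2\<close> it is the function \<open>f\<close> of the overview.\<close>

definition tie_limit :: "real \<Rightarrow> real \<Rightarrow> real \<Rightarrow> real" where
  "tie_limit p s y =
     p / (1 - p)\<^sup>2 * (1 / sqrt ((1 - (1 - p) * s)\<^sup>2 - 4 * ((1 - p) * y)\<^sup>2) - 1 - (1 - p) * s)"

lemma tie_limit_has_sum:
  assumes p: "0 < p" "p < 1" and s: "0 \<le> s" and y: "0 \<le> y" and le: "s + 2 * y \<le> 1"
  shows "((\<lambda>n. geometric_offspring p n * tie_branch s y n) has_sum tie_limit p s y) {2..}"
proof -
  let ?S = "1 / sqrt ((1 - (1 - p) * s)\<^sup>2 - 4 * ((1 - p) * y)\<^sup>2)"
  let ?f = "\<lambda>n. (1 - p) ^ n * tie_branch s y n"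
  have "(1 - p) * (s + 2 * y) \<le> (1 - p) * 1" by (intro mult_left_mono) (use assms in auto)
  then have "(1 - p) * (s + 2 * y) < 1" by (rule le_less_trans) (use p in simp)
  then have "(?f has_sum ?S) UNIV" using assms by (intro tie_branch_has_sum) simp_all
  moreover have "(?f has_sum (\<Sum>n<2. ?f n)) {..<2}" by (rule has_sum_finite) simp
  ultimately have "(?f has_sum (?S - (\<Sum>n<2. ?f n))) (UNIV - {..<2})"
    by (intro has_sum_Diff) auto
  also have "UNIV - {..<2} = {2::nat..}" by auto
  also have "(\<Sum>n<2. ?f n) = 1 + (1 - p) * s"
    using tie_weight_even[of y 0] tie_weight_odd[of 1 y] by (simp add: numeral_2_eq_2 tie_branch_def)
  finally have "((\<lambda>n. p / (1 - p)\<^sup>2 * ?f n) has_sum (p / (1 - p)\<^sup>2 * (?S - (1 + (1 - p) * s)))) {2..}"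
    by (rule has_sum_cmult_right)
  also have "?this \<longleftrightarrow> ((\<lambda>n. geometric_offspring p n * tie_branch s y n) has_sum
      (p / (1 - p)\<^sup>2 * (?S - (1 + (1 - p) * s)))) {2..}"
  proof (rule has_sum_cong)
    fix n :: nat assume "n \<in> {2..}"
    then have "n - 2 + 2 = n" by simp
    then have "(1 - p) ^ n = (1 - p) ^ (n - 2) * (1 - p)\<^sup>2"
      by (simp only: power_add[symmetric])
    then show "p / (1 - p)\<^sup>2 * ?f n = geometric_offspring p n * tie_branch s y n"
      using \<open>n \<in> {2..}\<close> p by (simp add: geometric_offspring_def)
  qed
  finally show ?thesis by (simp add: tie_limit_def diff_diff_eq)
qed

section \<open>One step of the recursion\<close>

definition branch_prob :: "nat \<Rightarrow> (nat \<Rightarrow> real) \<Rightarrow> nat \<Rightarrow> nat \<Rightarrow> real" where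
  "branch_prob k x i n =
     (\<Sum>a<n. real (n choose a) * x 0 ^ a * majority_weight k x i (n - a))"

lemma majority_prob_eq:
  "majority_prob q k x i = (\<Sum>\<^sub>\<infinity>n\<in>{2..}. q n * branch_prob k x i n)"
proof -
  have "{0..n - 1} = {..<n}" if "n \<in> {2..}" for n :: nat using that by auto
  then show ?thesis
    unfolding majority_prob_def branch_prob_def majority_weight_def word_weight_def
    by (intro infsum_cong) simp
qed

lemma opinion_lawsD:
  assumes "x \<in> opinion_laws k"
  shows "0 \<le> x i" "x i \<le> 1" "(\<Sum>j=1..k. x j) = 1 - x 0" "x 0 < 1"
proof -
  show nn: "0 \<le> x i" for i
    using assms by (cases "i \<le> k") (auto simp: opinion_laws_def)
  have "(\<Sum>j=0..k. x j) = 1" using assms by (simp add: opinion_laws_def)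
  moreover from this show "(\<Sum>j=1..k. x j) = 1 - x 0"
    by (simp add: sum.atLeast_Suc_atMost)
  ultimately show "x i \<le> 1"
    using assms member_le_sum[of i "{0..k}" x] nn
    by (cases "i \<le> k") (auto simp: opinion_laws_def)
  show "x 0 < 1" using assms by (simp add: opinion_laws_def)
qed

lemma has_sum_diff:
  fixes f g :: "'a \<Rightarrow> 'b :: real_normed_vector"
  assumes "(f has_sum a) A" "(g has_sum b) A"
  shows "((\<lambda>n. f n - g n) has_sum (a - b)) A"
  using has_sum_add[OF assms(1), of "\<lambda>n. - g n" "- b"] assms(2) by (simp add: has_sum_uminus)

abbreviation (input) majority_step :: "real \<Rightarrow> nat \<Rightarrow> (nat \<Rightarrow> real) \<Rightarrow> nat \<Rightarrow> real" where
  "majority_step p k \<equiv> majority_map (geometric_offspring p) k"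

context
  fixes k :: nat and x :: "nat \<Rightarrow> real"
  assumes k: "2 \<le> k" and x: "x \<in> opinion_laws k"
begin

lemma branch_prob_nonneg: "0 \<le> branch_prob k x i n"
  unfolding branch_prob_def
  by (intro sum_nonneg mult_nonneg_nonneg majority_weight_nonneg) (use opinion_lawsD[OF x] in auto)

lemma branch_prob_ratio:
  assumes "i \<in> {1..k}" "j \<in> {1..k}" "i \<noteq> j" "0 \<le> \<rho>" "\<rho> \<le> 1" "x j \<le> \<rho> * x i"
  shows "branch_prob k x j n \<le> \<rho> * branch_prob k x i n"
proof -
  have "branch_prob k x j n
      \<le> (\<Sum>a<n. real (n choose a) * x 0 ^ a * (\<rho> * majority_weight k x i (n - a)))"
    unfolding branch_prob_def
    by (intro sum_mono mult_left_mono majority_weight_ratio)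
      (use assms opinion_lawsD[OF x] in auto)
  also have "\<dots> = \<rho> * branch_prob k x i n"
    by (simp add: branch_prob_def sum_distrib_left mult_ac)
  finally show ?thesis .
qed

text \<open>Either both children hold \<open>i\<close>, or one does and the other is undecided. The
  first case is the source of the strict gain in the ratio estimate.\<close>

lemma branch_prob_2: "i \<in> {1..k} \<Longrightarrow> branch_prob k x i 2 = (x i)\<^sup>2 + 2 * x 0 * x i"
  by (simp add: branch_prob_def numeral_2_eq_2 majority_weight_small[of i k 1, simplified]
      majority_weight_small[of i k 2, simplified, unfolded numeral_2_eq_2])

text \<open>Keeps only the families whose single decided child holds \<open>i\<close>. There are
  \<open>n\<close> places for that child, and the factor 2 from \<open>2 \<le> n\<close> is what
  makes the fully undecided state repelling.\<close>

lemma branch_prob_ge: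
  assumes "i \<in> {1..k}" "2 \<le> n"
  shows "2 * x 0 ^ (n - 1) * x i \<le> branch_prob k x i n"
proof -
  let ?f = "\<lambda>a. real (n choose a) * x 0 ^ a * majority_weight k x i (n - a)"
  have "2 * x 0 ^ (n - 1) * x i \<le> real n * x 0 ^ (n - 1) * x i"
    by (intro mult_right_mono) (use assms opinion_lawsD[OF x] in auto)
  also have "real n = real (n choose (n - 1))"
    using binomial_symmetric[of 1 n] assms(2) by simp
  also have "real (n choose (n - 1)) * x 0 ^ (n - 1) * x i = ?f (n - 1)"
    using assms majority_weight_small[of i k 1 x] by simp
  also have "\<dots> \<le> branch_prob k x i n"
    unfolding branch_prob_def
    by (rule member_le_sum[of "n - 1" "{..<n}" ?f])
      (use assms opinion_lawsD[OF x] in \<open>auto intro!: mult_nonneg_nonneg majority_weight_nonneg\<close>)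
  finally show ?thesis .
qed

context
  assumes sym: "x 1 = x 2"
begin

lemma branch_prob_sum_le:
  "(\<Sum>i=1..k. branch_prob k x i n) \<le> 1 - tie_branch (x 0) (x 1) n"
proof -
  have "(\<Sum>i=1..k. branch_prob k x i n)
      = (\<Sum>a<n. real (n choose a) * x 0 ^ a * (\<Sum>i=1..k. majority_weight k x i (n - a)))"
    unfolding branch_prob_def by (subst sum.swap) (simp add: sum_distrib_left)
  also have "\<dots> \<le> (\<Sum>a<n. real (n choose a) * x 0 ^ a *
      ((1 - x 0) ^ (n - a) - tie_weight (x 1) (n - a)))"
  proof (intro sum_mono mult_left_mono)
    fix a
    show "(\<Sum>i=1..k. majority_weight k x i (n - a)) \<le> (1 - x 0) ^ (n - a) - tie_weight (x 1) (n - a)"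
      using majority_weight_sum_le[OF k, of x "x 1" "n - a"] opinion_lawsD[OF x] sym by simp
  qed (use opinion_lawsD[OF x] in auto)
  \<comment> \<open>The added term \<open>a = n\<close> is zero: both the power and the tie weight
    at 0 are 1. It completes the binomial sum.\<close>
  also have "\<dots> = (\<Sum>a\<le>n. real (n choose a) * x 0 ^ a *
      ((1 - x 0) ^ (n - a) - tie_weight (x 1) (n - a)))"
    using tie_weight_even[of "x 1" 0] by (simp add: lessThan_Suc_atMost[symmetric])
  also have "\<dots> = (x 0 + (1 - x 0)) ^ n - tie_branch (x 0) (x 1) n"
    unfolding binomial_ring tie_branch_def by (simp only: right_diff_distrib sum_subtractf)
  finally show ?thesis by simp
qed

lemma branch_prob_pair_ge:
  "(x 0 + 2 * x 1) ^ n - tie_branch (x 0) (x 1) n \<le> branch_prob k x 1 n + branch_prob k x 2 n"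
proof -
  have "(x 0 + 2 * x 1) ^ n - tie_branch (x 0) (x 1) n
      = (\<Sum>a\<le>n. real (n choose a) * x 0 ^ a * ((2 * x 1) ^ (n - a) - tie_weight (x 1) (n - a)))"
    unfolding binomial_ring tie_branch_def by (simp only: right_diff_distrib sum_subtractf)
  also have "\<dots> = (\<Sum>a<n. real (n choose a) * x 0 ^ a *
      ((2 * x 1) ^ (n - a) - tie_weight (x 1) (n - a)))"
    using tie_weight_even[of "x 1" 0] by (simp add: lessThan_Suc_atMost[symmetric])
  also have "\<dots> \<le> (\<Sum>a<n. real (n choose a) * x 0 ^ a *
      (majority_weight k x 1 (n - a) + majority_weight k x 2 (n - a)))"
    by (intro sum_mono mult_left_mono majority_weight_pair_ge k)
      (use opinion_lawsD[OF x] sym in auto)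
  also have "\<dots> = branch_prob k x 1 n + branch_prob k x 2 n"
    unfolding branch_prob_def by (simp only: distrib_left sum.distrib)
  finally show ?thesis .
qed

context
  fixes p :: real
  assumes p: "0 < p" "p < 1"
begin

lemma branch_prob_le_1: "i \<in> {1..k} \<Longrightarrow> branch_prob k x i n \<le> 1"
proof -
  assume "i \<in> {1..k}"
  then have "branch_prob k x i n \<le> (\<Sum>i=1..k. branch_prob k x i n)"
    by (intro member_le_sum) (auto intro: branch_prob_nonneg)
  then show ?thesis
    using branch_prob_sum_le[of n] tie_branch_nonneg[of "x 0" "x 1" n] opinion_lawsD(1)[OF x]
    by (smt (verit))
qed

text \<open>Since \<open>infsum\<close> is 0 by default on a family that is not summable,
  summability is settled first, by comparison with the offspring law.\<close>

lemma majority_prob_has_sum: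
  assumes "i \<in> {1..k}"
  shows "((\<lambda>n. geometric_offspring p n * branch_prob k x i n)
    has_sum majority_prob (geometric_offspring p) k x i) {2..}"
  unfolding majority_prob_eq
proof (rule has_sum_infsum)
  have "(geometric_offspring p) summable_on {2..}"
    using geometric_offspring_has_sum[OF p, of 1] by (auto simp: summable_on_def)
  then show "(\<lambda>n. geometric_offspring p n * branch_prob k x i n) summable_on {2..}"
    by (rule summable_on_comparison_test)
      (use assms p in \<open>auto intro!: mult_left_le mult_nonneg_nonneg branch_prob_le_1
        branch_prob_nonneg geometric_offspring_nonneg\<close>)
qed

lemma majority_prob_sum_has_sum:
  assumes "I \<subseteq> {1..k}"
  shows "((\<lambda>n. geometric_offspring p n * (\<Sum>i\<in>I. branch_prob k x i n))
    has_sum (\<Sum>i\<in>I. majority_prob (geometric_offspring p) k x i)) {2..}"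
proof -
  have "finite I" using assms by (rule finite_subset) simp
  then show ?thesis using assms
  proof induction
    case (insert i I)
    have "((\<lambda>n. geometric_offspring p n * branch_prob k x i n
        + geometric_offspring p n * (\<Sum>i\<in>I. branch_prob k x i n))
      has_sum (majority_prob (geometric_offspring p) k x i
        + (\<Sum>i\<in>I. majority_prob (geometric_offspring p) k x i))) {2..}"
      by (rule has_sum_add[OF majority_prob_has_sum insert.IH]) (use insert.prems in auto)
    then show ?case using insert.hyps by (simp add: distrib_left)
  qed simp
qed

lemma pair_mass_le: "x 0 + 2 * x 1 \<le> 1"
proof -
  have "0 \<le> (\<Sum>j=3..k. x j)" by (intro sum_nonneg opinion_lawsD[OF x])
  then show ?thesis using opinion_lawsD(3)[OF x] sum_split_2[OF k, of x] sym by simp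
qed

lemma majority_map_eq: "i \<in> {1..k} \<Longrightarrow> majority_step p k x i = majority_prob (geometric_offspring p) k x i"
  by (simp add: majority_map_def)

lemma majority_map_nonneg: "i \<in> {1..k} \<Longrightarrow> 0 \<le> majority_step p k x i"
  unfolding majority_map_eq
  by (rule has_sum_nonneg[OF majority_prob_has_sum])
    (auto intro!: mult_nonneg_nonneg branch_prob_nonneg geometric_offspring_nonneg p)

lemma majority_map_sum: "(\<Sum>j=1..k. majority_step p k x j) = 1 - majority_step p k x 0"
proof -
  have "(\<Sum>j=1..k. majority_step p k x j) = (\<Sum>j=1..k. majority_prob (geometric_offspring p) k x j)"
    by (rule sum.cong) (simp_all add: majority_map_eq)
  then show ?thesis by (simp add: majority_map_def)
qed

lemma geometric_offspring_sum: "((\<lambda>n. geometric_offspring p n * 1) has_sum 1) {2..}"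
  using geometric_offspring_has_sum[OF p, of 1] p by simp

text \<open>A vertex is certainly undecided when its decided children, all of opinion 1 or 2, split
  evenly; \<open>tie_limit\<close> is the probability of that event.\<close>

lemma undecided_ge: "tie_limit p (x 0) (x 1) \<le> majority_step p k x 0"
proof -
  have "(\<Sum>j=1..k. majority_prob (geometric_offspring p) k x j) \<le> 1 - tie_limit p (x 0) (x 1)"
  proof (rule has_sum_mono[OF majority_prob_sum_has_sum])
    show "((\<lambda>n. geometric_offspring p n * 1 - geometric_offspring p n * tie_branch (x 0) (x 1) n)
        has_sum (1 - tie_limit p (x 0) (x 1))) {2..}"
      by (intro has_sum_diff geometric_offspring_sum tie_limit_has_sum p pair_mass_le
          opinion_lawsD(1)[OF x])
    fix n :: nat
    show "geometric_offspring p n * (\<Sum>i=1..k. branch_prob k x i n)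
        \<le> geometric_offspring p n * 1 - geometric_offspring p n * tie_branch (x 0) (x 1) n"
      unfolding right_diff_distrib[symmetric]
      by (intro mult_left_mono branch_prob_sum_le geometric_offspring_nonneg p)
  qed simp
  then show ?thesis by (simp add: majority_map_def)
qed

lemma undecided_nonneg: "0 \<le> majority_step p k x 0"
proof -
  have "0 \<le> tie_limit p (x 0) (x 1)"
    by (rule has_sum_nonneg[OF tie_limit_has_sum])
      (use pair_mass_le in \<open>auto intro!: mult_nonneg_nonneg tie_branch_nonneg
        geometric_offspring_nonneg p opinion_lawsD(1)[OF x]\<close>)
  also note undecided_ge
  finally show ?thesis .
qed

text \<open>\<sigma> is the mass of the opinions \<open>3, ..., k\<close>. Without a child of such
  an opinion, being undecided means a tie of 1 and 2 or no decided child. The extra term is the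
  probability that such a child exists, one minus the offspring generating function at
  \<open>1 - \<sigma>\<close>.\<close>

lemma undecided_le:
  fixes \<sigma> :: real
  defines "\<sigma> \<equiv> 1 - (x 0 + 2 * x 1)"
  shows "majority_step p k x 0 \<le> tie_limit p (x 0) (x 1) + (1 - p * (1 - \<sigma>)\<^sup>2 / (1 - (1 - p) * (1 - \<sigma>)))"
proof -
  have \<sigma>: "0 \<le> 1 - \<sigma>" "1 - \<sigma> \<le> 1"
    using opinion_lawsD(1)[OF x] pair_mass_le by (simp_all add: \<sigma>_def)
  have "((\<lambda>n. (1 - \<sigma>) * (geometric_offspring p n * (1 - \<sigma>) ^ (n - 1))) has_sum
      ((1 - \<sigma>) * (p * (1 - \<sigma>) / (1 - (1 - p) * (1 - \<sigma>))))) {2..}"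
    by (intro has_sum_cmult_right geometric_offspring_has_sum p \<sigma>)
  also have "?this \<longleftrightarrow> ((\<lambda>n. geometric_offspring p n * (1 - \<sigma>) ^ n) has_sum
      (p * (1 - \<sigma>)\<^sup>2 / (1 - (1 - p) * (1 - \<sigma>)))) {2..}"
  proof (rule arg_cong2[where f = "\<lambda>u v. (u has_sum v) _", THEN trans, OF refl _ has_sum_cong])
    fix n :: nat assume "n \<in> {2..}"
    then have "(1 - \<sigma>) * (1 - \<sigma>) ^ (n - 1) = (1 - \<sigma>) ^ n"
      by (cases n) auto
    then show "(1 - \<sigma>) * (geometric_offspring p n * (1 - \<sigma>) ^ (n - 1))
        = geometric_offspring p n * (1 - \<sigma>) ^ n" by (simp add: mult.left_commute)
  qed (simp add: power2_eq_square)
  finally have G: "((\<lambda>n. geometric_offspring p n * (1 - \<sigma>) ^ n) has_sum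
      (p * (1 - \<sigma>)\<^sup>2 / (1 - (1 - p) * (1 - \<sigma>)))) {2..}" .
  have "p * (1 - \<sigma>)\<^sup>2 / (1 - (1 - p) * (1 - \<sigma>)) - tie_limit p (x 0) (x 1)
      \<le> (\<Sum>j\<in>{1, 2}. majority_prob (geometric_offspring p) k x j)"
  proof (rule has_sum_mono[OF has_sum_diff[OF G tie_limit_has_sum] majority_prob_sum_has_sum])
    fix n :: nat
    have "(1 - \<sigma>) ^ n - tie_branch (x 0) (x 1) n \<le> (\<Sum>i\<in>{1, 2}. branch_prob k x i n)"
      using branch_prob_pair_ge[of n] by (simp add: \<sigma>_def)
    then show "geometric_offspring p n * (1 - \<sigma>) ^ n - geometric_offspring p n * tie_branch (x 0) (x 1) n
        \<le> geometric_offspring p n * (\<Sum>i\<in>{1, 2}. branch_prob k x i n)"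
      unfolding right_diff_distrib[symmetric]
      by (intro mult_left_mono geometric_offspring_nonneg p)
  qed (use k p pair_mass_le opinion_lawsD(1)[OF x] in auto)
  also have "\<dots> = (\<Sum>j\<in>{1, 2}. majority_step p k x j)"
    using k by (intro sum.cong) (auto simp: majority_map_eq)
  also have "\<dots> \<le> (\<Sum>j=1..k. majority_step p k x j)"
    using k by (intro sum_mono2) (auto intro: majority_map_nonneg)
  finally show ?thesis unfolding majority_map_sum by linarith
qed

text \<open>For every \<open>n\<close> the factor \<rho> survives by the exchange argument. For
  \<open>n = 2\<close>, of probability \<open>p\<close>, squaring the hypothesis gives
  \<open>\<rho> ^ 2\<close> where \<rho> would suffice; the difference
  \<open>\<rho> * (1 - \<rho>)\<close> is the gain.\<close>

lemma majority_map_ratio: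
  assumes "i \<in> {1..k}" "j \<in> {1..k}" "i \<noteq> j" "0 \<le> \<rho>" "\<rho> \<le> 1" "x j \<le> \<rho> * x i"
  shows "majority_step p k x j \<le> \<rho> * majority_step p k x i - p * \<rho> * (1 - \<rho>) * (x i)\<^sup>2"
proof -
  let ?c = "p * \<rho> * (1 - \<rho>) * (x i)\<^sup>2"
  have "majority_prob (geometric_offspring p) k x j
      \<le> \<rho> * majority_prob (geometric_offspring p) k x i - ?c"
  proof (rule has_sum_mono[OF majority_prob_has_sum
        has_sum_diff[OF has_sum_cmult_right[OF majority_prob_has_sum]]])
    show "((\<lambda>n. if n = 2 then ?c else 0) has_sum ?c) {2::nat..}"
      by (rule has_sum_finite_neutralI[of "{2::nat}"]) auto
    fix n :: nat assume n: "n \<in> {2..}"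
    show "geometric_offspring p n * branch_prob k x j n
        \<le> \<rho> * (geometric_offspring p n * branch_prob k x i n) - (if n = 2 then ?c else 0)"
    proof (cases "n = 2")
      case True
      have "(x j)\<^sup>2 \<le> (\<rho> * x i)\<^sup>2"
        by (intro power_mono assms opinion_lawsD(1)[OF x])
      moreover have "2 * x 0 * x j \<le> 2 * x 0 * (\<rho> * x i)"
        by (intro mult_left_mono assms) (simp add: opinion_lawsD(1)[OF x])
      ultimately have "branch_prob k x j 2 \<le> \<rho> * branch_prob k x i 2 - \<rho> * (1 - \<rho>) * (x i)\<^sup>2"
        using assms(1,2) by (simp add: branch_prob_2 algebra_simps power2_eq_square)
      then have "p * branch_prob k x j 2 \<le> p * (\<rho> * branch_prob k x i 2 - \<rho> * (1 - \<rho>) * (x i)\<^sup>2)"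
        by (intro mult_left_mono) (use p in auto)
      also have "\<dots> = \<rho> * (p * branch_prob k x i 2) - ?c" by algebra
      finally show ?thesis using True by (simp add: geometric_offspring_def)
    next
      case False
      have "geometric_offspring p n * branch_prob k x j n
          \<le> geometric_offspring p n * (\<rho> * branch_prob k x i n)"
        by (intro mult_left_mono branch_prob_ratio assms geometric_offspring_nonneg p)
      then show ?thesis using False by (simp add: mult.left_commute)
    qed
  qed (use assms in auto)
  then show ?thesis using assms by (simp add: majority_map_eq)
qed

text \<open>The ratio estimate with \<open>\<rho> = 1\<close>, where its gain vanishes, is used in
  both directions.\<close>

lemma majority_map_sym: "majority_step p k x 1 = majority_step p k x 2"
proof -
  have "majority_step p k x 2 \<le> majority_step p k x 1" "majority_step p k x 1 \<le> majority_step p k x 2"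
    using majority_map_ratio[of 1 2 1] majority_map_ratio[of 2 1 1] k sym by auto
  then show ?thesis by simp
qed

text \<open>Keeps only the event of exactly two children, both of opinion \<open>i\<close>.\<close>

lemma majority_map_ge_square:
  assumes "i \<in> {1..k}"
  shows "p * (x i)\<^sup>2 \<le> majority_step p k x i"
proof -
  have "p * (x i)\<^sup>2 \<le> majority_prob (geometric_offspring p) k x i"
  proof (rule has_sum_mono[OF _ majority_prob_has_sum[OF assms]])
    show "((\<lambda>n. if n = 2 then p * (x i)\<^sup>2 else 0) has_sum p * (x i)\<^sup>2) {2::nat..}"
      by (rule has_sum_finite_neutralI[of "{2::nat}"]) auto
    fix n :: nat
    have "0 \<le> p * (2 * x 0 * x i)" using p opinion_lawsD(1)[OF x] by simp
    then have "p * (x i)\<^sup>2 \<le> p * branch_prob k x i 2"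
      using assms by (simp add: branch_prob_2 distrib_left)
    moreover have "0 \<le> geometric_offspring p n * branch_prob k x i n"
      by (intro mult_nonneg_nonneg branch_prob_nonneg geometric_offspring_nonneg p)
    ultimately show "(if n = 2 then p * (x i)\<^sup>2 else 0) \<le> geometric_offspring p n * branch_prob k x i n"
      by (simp add: geometric_offspring_def)
  qed
  then show ?thesis using assms by (simp add: majority_map_eq)
qed

text \<open>Averages the families with a single decided child over \<open>n\<close> and sums over
  \<open>i\<close>. The growth factor is at least 1 exactly when
  \<open>x 0 * (1 + p) \<ge> 1\<close>, and equals 2 at \<open>x 0 = 1\<close>.\<close>

lemma decided_ge: "(1 - x 0) * (2 * p * x 0 / (1 - (1 - p) * x 0)) \<le> 1 - majority_step p k x 0"
proof -
  let ?c = "2 * p * x 0 / (1 - (1 - p) * x 0)"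
  have "x i * ?c \<le> majority_step p k x i" if i: "i \<in> {1..k}" for i
  proof -
    have "2 * x i * (p * x 0 / (1 - (1 - p) * x 0)) \<le> majority_prob (geometric_offspring p) k x i"
    proof (rule has_sum_mono[OF has_sum_cmult_right[OF geometric_offspring_has_sum[OF p]]
          majority_prob_has_sum[OF i]])
      fix n :: nat assume "n \<in> {2..}"
      then have "geometric_offspring p n * (2 * x 0 ^ (n - 1) * x i)
          \<le> geometric_offspring p n * branch_prob k x i n"
        by (intro mult_left_mono branch_prob_ge i geometric_offspring_nonneg p) auto
      then show "2 * x i * (geometric_offspring p n * x 0 ^ (n - 1))
          \<le> geometric_offspring p n * branch_prob k x i n"
        by (simp add: mult_ac)
    qed (use opinion_lawsD[OF x] in auto)
    then show ?thesis using i by (simp add: majority_map_eq mult_ac)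
  qed
  then have "(\<Sum>i=1..k. x i * ?c) \<le> (\<Sum>i=1..k. majority_step p k x i)" by (intro sum_mono)
  then show ?thesis
    unfolding sum_distrib_right[symmetric] opinion_lawsD(3)[OF x] majority_map_sum .
qed

end

end

end

section \<open>Convergence\<close>

lemma inverse_sqrt_diff_le:
  fixes A B p :: real
  assumes "0 < p" "p\<^sup>2 \<le> A" "p\<^sup>2 \<le> B"
  shows "\<bar>1 / sqrt A - 1 / sqrt B\<bar> \<le> \<bar>A - B\<bar> / (2 * p ^ 3)"
proof -
  define a b where "a = sqrt A" and "b = sqrt B"
  have ab: "p \<le> a" "p \<le> b" using assms by (auto simp: a_def b_def real_le_rsqrt)
  have pos: "0 < A" "0 < B" using assms by (auto intro: less_le_trans[of _ "p\<^sup>2"])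
  have sq: "A = a\<^sup>2" "B = b\<^sup>2" using pos by (simp_all add: a_def b_def)
  have "1 / a - 1 / b = (B - A) / (a * b * (a + b))"
  proof -
    have "a \<noteq> 0" "b \<noteq> 0" "a + b \<noteq> 0" using ab assms(1) by auto
    then show ?thesis unfolding sq by (simp add: divide_simps) algebra
  qed
  moreover have "p * p * (p + p) \<le> a * b * (a + b)"
    by (intro mult_mono add_mono) (use ab assms(1) in auto)
  then have "2 * p ^ 3 \<le> a * b * (a + b)" by (simp add: power3_eq_cube)
  moreover have "0 < 2 * p ^ 3" using assms(1) by simp
  ultimately show ?thesis
    unfolding a_def[symmetric] b_def[symmetric]
    by (simp add: abs_minus_commute[of B A] frac_le)
qed

text \<open>The radicand is a difference of squares; with \<open>2 * y = 1 - s - \<sigma>\<close>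
  its smaller factor becomes \<open>p + (1 - p) * \<sigma>\<close>. At \<open>\<sigma> = 0\<close>
  the root is \<open>v(s)\<close> of the overview.\<close>

lemma tie_limit_pair_mass:
  "tie_limit p s ((1 - s - \<sigma>) / 2) = p / (1 - p)\<^sup>2 *
     (1 / sqrt ((p + (1 - p) * \<sigma>) * (2 - p - 2 * (1 - p) * s - (1 - p) * \<sigma>)) - 1 - (1 - p) * s)"
proof -
  have "(1 - (1 - p) * s)\<^sup>2 - 4 * ((1 - p) * ((1 - s - \<sigma>) / 2))\<^sup>2
      = (p + (1 - p) * \<sigma>) * (2 - p - 2 * (1 - p) * s - (1 - p) * \<sigma>)"
    by (simp add: power2_eq_square field_simps)
  then show ?thesis by (simp add: tie_limit_def)
qed

text \<open>The radicands \<open>A\<close> and \<open>B\<close> with and without minor opinions are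
  at least \<open>p\<close> squared and differ by at most \<open>2 * \<sigma>\<close>, so the
  inverse roots differ by at most \<open>\<sigma> / p ^ 3\<close>.\<close>

lemma tie_limit_perturb:
  assumes p: "0 < p" "p < 1" and s: "0 \<le> s" and \<sigma>: "0 \<le> \<sigma>" "\<sigma> \<le> 1 - s"
  shows "\<bar>tie_limit p s ((1 - s - \<sigma>) / 2) - tie_limit p s ((1 - s) / 2)\<bar> \<le> \<sigma> / ((1 - p)\<^sup>2 * p\<^sup>2)"
proof -
  define r where "r = 1 - p"
  have r: "0 < r" "r < 1" using p by (auto simp: r_def)
  define A where "A = (p + r * \<sigma>) * (2 - p - 2 * r * s - r * \<sigma>)"
  define B where "B = p * (2 - p - 2 * r * s)"
  have rs: "r * \<sigma> \<le> r * (1 - s)" "0 \<le> r * \<sigma>" "0 \<le> r * s" "r * s \<le> r"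
    using r s \<sigma> by (auto intro: mult_left_le)
  have f: "p \<le> 2 - p - 2 * r * s - r * \<sigma>"
    using rs r_def unfolding right_diff_distrib mult.assoc by linarith
  have pA: "p * p \<le> A" unfolding A_def
    by (rule mult_mono) (use f rs p in auto)
  have pB: "p * p \<le> B" unfolding B_def
    by (rule mult_left_mono) (use f rs p in auto)
  have AB: "A - B = r * \<sigma> * (2 * r * (1 - s) - r * \<sigma>)"
    by (simp add: A_def B_def r_def algebra_simps)
  have t: "0 \<le> 2 * r * (1 - s) - r * \<sigma>" "2 * r * (1 - s) - r * \<sigma> \<le> 2"
    using rs r by (auto simp: algebra_simps)
  have "\<bar>A - B\<bar> = r * \<sigma> * (2 * r * (1 - s) - r * \<sigma>)" using AB t rs by simp
  also have "\<dots> \<le> \<sigma> * 2"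
    by (intro mult_mono) (use t rs r \<sigma> in \<open>auto intro: mult_left_le_one_le\<close>)
  finally have AB': "\<bar>A - B\<bar> \<le> 2 * \<sigma>" by simp
  have "\<bar>1 / sqrt A - 1 / sqrt B\<bar> \<le> \<bar>A - B\<bar> / (2 * p ^ 3)"
    by (rule inverse_sqrt_diff_le) (use p pA pB in \<open>auto simp: power2_eq_square\<close>)
  also have "\<dots> \<le> 2 * \<sigma> / (2 * p ^ 3)"
    by (intro divide_right_mono AB') (use p in auto)
  finally have D: "\<bar>1 / sqrt A - 1 / sqrt B\<bar> \<le> \<sigma> / p ^ 3" by simp
  have "tie_limit p s ((1 - s - \<sigma>) / 2) - tie_limit p s ((1 - s) / 2)
      = p / r\<^sup>2 * (1 / sqrt A - 1 / sqrt B)"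
    using tie_limit_pair_mass[of p s \<sigma>] tie_limit_pair_mass[of p s 0]
    by (simp add: A_def B_def r_def algebra_simps)
  then have "\<bar>tie_limit p s ((1 - s - \<sigma>) / 2) - tie_limit p s ((1 - s) / 2)\<bar>
      = p / r\<^sup>2 * \<bar>1 / sqrt A - 1 / sqrt B\<bar>"
    using p by (simp add: abs_mult)
  also have "\<dots> \<le> p / r\<^sup>2 * (\<sigma> / p ^ 3)"
    by (intro mult_left_mono D) (use p in auto)
  also have "\<dots> = \<sigma> / (r\<^sup>2 * p\<^sup>2)"
    using p by (simp add: power2_eq_square power3_eq_cube)
  finally show ?thesis by (simp add: r_def)
qed

text \<open>The chord slope from \<alpha> decreases in \<open>v\<close>. It would reach 1 at
  \<open>v = p\<close>, that is at the other fixed point \<open>s = 1\<close>; keeping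
  \<open>s\<close> below \<open>1 - \<epsilon>\<close> keeps \<open>v\<close> above a value greater
  than \<open>p\<close>.\<close>

lemma tie_limit_contraction:
  fixes p \<alpha> \<epsilon> :: real
  assumes p: "0 < p" "p < 1" and \<epsilon>: "0 < \<epsilon>"
    and \<alpha>: "\<alpha> = (- 3 * p + sqrt (p * (p + 8))) / (4 * (1 - p))"
  obtains c where "0 \<le> c" "c < 1"
    "\<And>s. 0 \<le> s \<Longrightarrow> s \<le> 1 - \<epsilon> \<Longrightarrow> \<bar>tie_limit p s ((1 - s) / 2) - \<alpha>\<bar> \<le> c * \<bar>s - \<alpha>\<bar>"
proof -
  define r where "r = 1 - p"
  have r: "0 < r" "r < 1" using p by (auto simp: r_def)
  \<comment> \<open>\<open>W\<close> stands for \<open>p + r * \<alpha>\<close>. It is the positive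
    root of \<open>2 * W^2 = p * W + p\<close>, so the later identities reduce to polynomial
    algebra.\<close>
  define W where "W = (p + sqrt (p * (p + 8))) / 4"
  have "0 < W" using p by (simp add: W_def add_pos_pos)
  define S where "S = sqrt (p * (p + 8))"
  have "S\<^sup>2 = p * (p + 8)" using p by (simp add: S_def)
  moreover have "S = 4 * W - p" unfolding W_def S_def[symmetric] by (simp add: field_simps)
  ultimately have "(4 * W - p)\<^sup>2 = p * (p + 8)" by simp
  then have WW: "2 * W\<^sup>2 = p * W + p" by (simp add: power2_eq_square algebra_simps)
  have \<alpha>W: "r * \<alpha> = W - p"
    using r p by (simp add: \<alpha> W_def r_def field_simps)
  \<comment> \<open>The value \<open>v(\<alpha>)\<close>, written rationally in \<open>W\<close>;
    the next fact confirms its square.\<close>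
  define w where "w = p / W"
  have "0 < w" using \<open>0 < W\<close> p by (simp add: w_def)
  have w2: "w\<^sup>2 = p * (2 - p - 2 * r * \<alpha>)"
  proof -
    have "W\<^sup>2 * (2 + p - 2 * W) = p" using WW by algebra
    then have "w\<^sup>2 = p\<^sup>2 / W\<^sup>2 \<and> p\<^sup>2 = p * (W\<^sup>2 * (2 + p - 2 * W))"
      by (simp add: w_def power_divide power2_eq_square)
    then have "w\<^sup>2 = p * (2 + p - 2 * W)" using \<open>0 < W\<close> by simp
    moreover have "2 + p - 2 * W = 2 - p - 2 * r * \<alpha>" using \<alpha>W by (simp add: mult.assoc)
    ultimately show ?thesis by simp
  qed
  \<comment> \<open>This encodes that 1 is a fixed point too: \<open>v(1) = p\<close>, and the chord
    from \<alpha> to 1 has slope 1.\<close>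
  have ww: "w * (p + w) = 2 * p"
  proof -
    have "w * (p + w) = p\<^sup>2 * (W + 1) / W\<^sup>2"
      using \<open>0 < W\<close> by (simp add: w_def field_simps power2_eq_square)
    also have "p\<^sup>2 * (W + 1) = 2 * p * W\<^sup>2" using WW by algebra
    finally show ?thesis using \<open>0 < W\<close> by simp
  qed
  have fix\<alpha>: "\<alpha> = p / r\<^sup>2 * (1 / w - 1 - r * \<alpha>)"
  proof -
    have "p * (1 / w - 1 - r * \<alpha>) = r * (r * \<alpha>)"
      unfolding \<alpha>W using p \<open>0 < W\<close> by (simp add: w_def r_def field_simps)
    then have "p * (1 / w - 1 - r * \<alpha>) / r\<^sup>2 = \<alpha>" using r by (simp add: power2_eq_square)
    then show ?thesis by simp
  qed
  define V where "V = (\<lambda>s. sqrt (p * (2 - p - 2 * r * s)))"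
  define slope where "slope = (\<lambda>v. p / r * (2 * p / (v * w * (v + w)) - 1))"
  have V2: "0 < p * (2 - p - 2 * r * s)" "p\<^sup>2 < p * (2 - p - 2 * r * s)" if "s < 1" for s
  proof -
    have "r * s < r" using r that by simp
    moreover have "r = 1 - p" by (rule r_def)
    ultimately have "p < 2 - p - 2 * r * s" unfolding mult.assoc by linarith
    then show "0 < p * (2 - p - 2 * r * s)" "p\<^sup>2 < p * (2 - p - 2 * r * s)"
      using p by (simp_all add: power2_eq_square)
  qed
  have Vp: "p < V s" if "s < 1" for s
    using V2[OF that] unfolding V_def by (intro real_less_rsqrt)
  have le1: "p * (2 - p) \<le> 1"
    using zero_le_power2[of "1 - p"] by (simp add: power2_eq_square algebra_simps)
  have V1: "V s \<le> 1" if "0 \<le> s" for s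
  proof -
    have "0 \<le> r * s" using r that by simp
    then have "p * (2 - p - 2 * r * s) \<le> p * (2 - p)" using p by simp
    then show ?thesis unfolding V_def using le1 by simp
  qed
  \<comment> \<open>Needed to bound the radicand of \<open>w\<close> by
    \<open>p * (2 - p) \<le> 1\<close>. For \<open>W < p\<close> both \<open>p * W\<close> and
    \<open>p\<close> would exceed \<open>W^2\<close>, against the equation of
    \<open>W\<close>.\<close>
  have "0 \<le> r * \<alpha>"
  proof (rule ccontr)
    assume "\<not> 0 \<le> r * \<alpha>"
    then have "W < p" using \<alpha>W by simp
    then have "W\<^sup>2 < p * W" using \<open>0 < W\<close> by (simp add: power2_eq_square)
    moreover have "W\<^sup>2 < p"
      using \<open>W\<^sup>2 < p * W\<close> \<open>W < p\<close> p mult_left_le[of W p] \<open>0 < W\<close> by linarith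
    ultimately show False using WW by linarith
  qed
  then have "2 - p - 2 * r * \<alpha> \<le> 2 - p" by (simp add: mult.assoc)
  then have "p * (2 - p - 2 * r * \<alpha>) \<le> p * (2 - p)" using p by simp
  with w2 le1 have "w\<^sup>2 \<le> 1\<^sup>2" by simp
  then have w1: "w \<le> 1" by (rule power2_le_imp_le) simp
  have eq: "tie_limit p s ((1 - s) / 2) - \<alpha> = slope (V s) * (s - \<alpha>)" if "s < 1" for s
  proof -
    define v where "v = V s"
    have "0 < v" using Vp[OF that] p by (simp add: v_def)
    have v2: "v\<^sup>2 = p * (2 - p - 2 * r * s)" using V2(1)[OF that] by (simp add: v_def V_def)
    have "tie_limit p s ((1 - s) / 2) = p / r\<^sup>2 * (1 / v - 1 - r * s)"
      using tie_limit_pair_mass[of p s 0] by (simp add: v_def V_def r_def)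
    then have "tie_limit p s ((1 - s) / 2) - \<alpha>
        = p / r\<^sup>2 * (1 / v - 1 - r * s) - p / r\<^sup>2 * (1 / w - 1 - r * \<alpha>)"
      using fix\<alpha> by simp
    also have "\<dots> = p / r\<^sup>2 * ((1 / v - 1 / w) - r * (s - \<alpha>))"
    proof -
      have "a * (b - 1 - r * s) - a * (c - 1 - r * \<alpha>) = a * ((b - c) - r * (s - \<alpha>))"
        for a b c by algebra
      then show ?thesis .
    qed
    also have "1 / v - 1 / w = (w\<^sup>2 - v\<^sup>2) / (v * w * (v + w))"
    proof -
      have "v \<noteq> 0" "w \<noteq> 0" "v + w \<noteq> 0" using \<open>0 < v\<close> \<open>0 < w\<close> by auto
      then show ?thesis by (simp add: divide_simps) algebra
    qed
    also have "w\<^sup>2 - v\<^sup>2 = 2 * p * (r * (s - \<alpha>))"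
      unfolding w2 v2 by (simp add: algebra_simps)
    also have "p / r\<^sup>2 * (2 * p * (r * (s - \<alpha>)) / (v * w * (v + w)) - r * (s - \<alpha>))
        = p / r\<^sup>2 * r * (2 * p / (v * w * (v + w)) - 1) * (s - \<alpha>)"
    proof -
      have "a * (2 * p * (r * t) / D - r * t) = a * r * (2 * p / D - 1) * t" for a D t
        by (simp add: algebra_simps)
      then show ?thesis .
    qed
    also have "p / r\<^sup>2 * r = p / r" using r by (simp add: power2_eq_square)
    finally show ?thesis by (simp add: slope_def v_def)
  qed
  define v0 where "v0 = V (1 - \<epsilon>)"
  \<comment> \<open>The slope lies between \<open>- p\<close>, as \<open>v\<close> and
    \<open>w\<close> are at most 1, and its value at the smallest admissible \<open>v\<close>,
    namely \<open>v0\<close>.\<close>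
  define c where "c = max p (slope v0)"
  have v0: "p < v0" using Vp[of "1 - \<epsilon>"] \<epsilon> by (simp add: v0_def)
  have "slope v0 < 1"
  proof -
    have "p * w * (p + w) < v0 * w * (v0 + w)"
      by (intro mult_strict_mono[of "p * w"]) (use v0 p \<open>0 < w\<close> in auto)
    moreover have "p * w * (p + w) = 2 * p * p" using ww by algebra
    ultimately have "2 * p * p < v0 * w * (v0 + w)" by simp
    then have "2 * p / (v0 * w * (v0 + w)) < 2 * p / (2 * p * p)"
      using p by (intro divide_strict_left_mono) (auto intro!: mult_pos_pos add_pos_pos simp: v0 \<open>0 < w\<close> less_trans[OF _ v0])
    then have "slope v0 < p / r * (2 * p / (2 * p * p) - 1)"
      unfolding slope_def using p r by (intro mult_strict_left_mono) auto
    also have "\<dots> = 1" using p by (simp add: r_def field_simps)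
    finally show ?thesis .
  qed
  then have "c < 1" "0 \<le> c" using p by (auto simp: c_def)
  moreover have "\<bar>tie_limit p s ((1 - s) / 2) - \<alpha>\<bar> \<le> c * \<bar>s - \<alpha>\<bar>" if s: "0 \<le> s" "s \<le> 1 - \<epsilon>" for s
  proof -
    have "s < 1" using s \<epsilon> by simp
    have v: "0 < V s" "V s \<le> 1" "v0 \<le> V s"
    proof -
      show "0 < V s" "V s \<le> 1" using Vp[OF \<open>s < 1\<close>] p V1[OF s(1)] by auto
      have "r * s \<le> r * (1 - \<epsilon>)" using r s by (intro mult_left_mono) auto
      then show "v0 \<le> V s" unfolding v0_def V_def using p by simp
    qed
    have "V s * w * (V s + w) \<le> 1 * 1 * (1 + 1)"
      by (intro mult_mono add_mono) (use v w1 \<open>0 < w\<close> in auto)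
    then have "p \<le> 2 * p / (V s * w * (V s + w))"
      using v \<open>0 < w\<close> p by (simp add: pos_le_divide_eq)
    then have "p / r * (p - 1) \<le> slope (V s)"
      unfolding slope_def using p r by (intro mult_left_mono) auto
    moreover have "p / r * (p - 1) = - p" using r by (simp add: r_def field_simps)
    moreover have "slope (V s) \<le> slope v0"
    proof -
      have "v0 * w * (v0 + w) \<le> V s * w * (V s + w)"
        by (intro mult_mono add_mono) (use v v0 p \<open>0 < w\<close> in auto)
      moreover have "0 < v0 * w * (v0 + w)" using v0 p \<open>0 < w\<close> by simp
      ultimately show ?thesis
        unfolding slope_def using p r by (intro mult_left_mono diff_right_mono frac_le) auto
    qed
    ultimately have "\<bar>slope (V s)\<bar> \<le> c" by (auto simp: c_def abs_le_iff)
    then show ?thesis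
      unfolding eq[OF \<open>s < 1\<close>] abs_mult by (rule mult_right_mono) simp
  qed
  ultimately show ?thesis using that by blast
qed

section \<open>Decay of the minor opinions and passage to the limit\<close>

lemma perturbed_contraction_tendsto_0:
  fixes d e :: "nat \<Rightarrow> real"
  assumes "\<And>n. 0 \<le> d n" "0 \<le> c" "c < 1" "\<And>n. d (Suc n) \<le> c * d n + e n" "e \<longlonglongrightarrow> 0"
  shows "d \<longlonglongrightarrow> 0"
proof (rule LIMSEQ_I)
  fix \<epsilon> :: real assume \<epsilon>: "0 < \<epsilon>"
  \<comment> \<open>Chosen so that \<open>\<epsilon> / 2\<close> is the fixed point of
    \<open>t\<close> mapped to \<open>c * t + \<delta>\<close>; the excess over it then shrinks by
    \<open>c\<close> in each step.\<close>
  define \<delta> where "\<delta> = \<epsilon> / 2 * (1 - c)"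
  have "0 < \<delta>" using \<epsilon> assms(3) by (simp add: \<delta>_def)
  then obtain N where N: "\<And>n. N \<le> n \<Longrightarrow> e n \<le> \<delta>"
    using LIMSEQ_D[OF assms(5)] by fastforce
  have bound: "d (N + m) \<le> c ^ m * d N + \<epsilon> / 2" for m
  proof (induction m)
    case (Suc m)
    have "d (N + Suc m) \<le> c * d (N + m) + \<delta>" using assms(4)[of "N + m"] N[of "N + m"] by simp
    also have "c * d (N + m) \<le> c * (c ^ m * d N + \<epsilon> / 2)" by (rule mult_left_mono[OF Suc assms(2)])
    also have "c * (c ^ m * d N + \<epsilon> / 2) + \<delta> = c ^ Suc m * d N + \<epsilon> / 2"
      by (simp add: \<delta>_def field_simps)
    finally show ?case by simp
  qed (use \<epsilon> in simp)
  have "(\<lambda>m. c ^ m * d N) \<longlonglongrightarrow> 0 * d N"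
    by (intro tendsto_mult LIMSEQ_power_zero tendsto_const) (use assms in auto)
  then obtain M where M: "\<And>m. M \<le> m \<Longrightarrow> \<bar>c ^ m * d N\<bar> < \<epsilon> / 2"
    using LIMSEQ_D[of "\<lambda>m. c ^ m * d N" 0 "\<epsilon> / 2"] \<epsilon> by auto
  show "\<exists>n0. \<forall>n\<ge>n0. norm (d n - 0) < \<epsilon>"
  proof (intro exI allI impI)
    fix n assume "N + M \<le> n"
    then obtain m where "n = N + m" "M \<le> m" by (metis add.assoc le_add1 le_iff_add)
    then show "norm (d n - 0) < \<epsilon>" using bound[of m] M[of m] assms(1)[of n] by auto
  qed
qed

text \<open>The invariant of the iteration; \<open>\<rho>\<close> decays geometrically while \<open>\<epsilon>\<close> is kept.\<close>

definition leading_pair :: "nat \<Rightarrow> real \<Rightarrow> real \<Rightarrow> (nat \<Rightarrow> real) \<Rightarrow> bool" where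
  "leading_pair k \<epsilon> \<rho> x \<longleftrightarrow> x \<in> opinion_laws k \<and> x 1 = x 2 \<and> \<epsilon> \<le> 1 - x 0 \<and>
     (\<forall>j\<in>{3..k}. x j \<le> \<rho> * x 1)"

text \<open>Opinion 1 is the largest of the \<open>k\<close> opinions, hence at least their
  average.\<close>

lemma leading_pair_ge:
  assumes "leading_pair k \<epsilon> \<rho> x" "2 \<le> k" "0 \<le> \<rho>" "\<rho> \<le> 1"
  shows "(1 - x 0) / real k \<le> x 1"
proof -
  note x = opinion_lawsD[of x k]
  have xl: "x \<in> opinion_laws k" using assms by (simp add: leading_pair_def)
  have "x j \<le> x 1" if "j \<in> {1..k}" for j
  proof (cases "j \<in> {3..k}")
    case True
    then have "x j \<le> \<rho> * x 1" using assms(1) unfolding leading_pair_def by blast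
    also have "\<dots> \<le> x 1" using x(1)[OF xl] assms(3,4) by (simp add: mult_left_le_one_le)
    finally show ?thesis .
  next
    case False
    then have "j = 1 \<or> j = 2" using that by auto
    then show ?thesis using assms(1) by (auto simp: leading_pair_def)
  qed
  then have "(\<Sum>j=1..k. x j) \<le> (\<Sum>j=1..k. x 1)" by (rule sum_mono)
  then have "1 - x 0 \<le> real k * x 1" using x(3)[OF xl] by simp
  then show ?thesis using assms(2) by (simp add: pos_divide_le_eq mult.commute)
qed

text \<open>The gain of the ratio estimate is turned into a factor on the new \<open>x 1\<close>,
  which is at most 1. The fixed bound \<rho>0 on \<rho>, with
  \<open>\<epsilon> / k \<le> x 1\<close>, makes this factor the same in every step.\<close>

lemma leading_pair_step:
  assumes lp: "leading_pair k \<epsilon> \<rho> x" and k: "2 \<le> k" and p: "0 < p" "p < 1"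
    and \<rho>: "0 \<le> \<rho>" "\<rho> \<le> \<rho>0" "\<rho>0 \<le> 1"
    and \<epsilon>: "0 < \<epsilon>" "\<epsilon> \<le> p * (p / (1 + p) / real k)\<^sup>2"
  shows "leading_pair k \<epsilon> (\<rho> * (1 - p * (1 - \<rho>0) * (\<epsilon> / real k)\<^sup>2)) (majority_step p k x)"
proof -
  let ?y = "majority_step p k x"
  have x: "x \<in> opinion_laws k" and sym: "x 1 = x 2" and \<epsilon>x: "\<epsilon> \<le> 1 - x 0"
    and le: "\<And>j. j \<in> {3..k} \<Longrightarrow> x j \<le> \<rho> * x 1"
    using lp unfolding leading_pair_def by blast+
  have nn: "0 \<le> ?y i" if "i \<in> {1..k}" for i
    by (rule majority_map_nonneg[OF k x sym p that])
  have y0: "0 \<le> ?y 0" by (rule undecided_nonneg[OF k x sym p])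
  have sum: "(\<Sum>j=1..k. ?y j) = 1 - ?y 0" by (rule majority_map_sum[OF k x sym p])
  have y1: "?y 1 \<le> 1 - ?y 0"
    unfolding sum[symmetric] by (rule member_le_sum) (use k nn in auto)
  have x1: "(1 - x 0) / real k \<le> x 1" by (rule leading_pair_ge[OF lp k]) (use \<rho> in auto)
  \<comment> \<open>If \<open>x 0\<close> is large, the decided mass does not decrease. Otherwise
    \<open>1 - x 0\<close> is at least \<open>p / (1 + p)\<close>, so \<open>x 1\<close> is at least
    that over \<open>k\<close>, and two children of opinion 1 already give mass \<epsilon>.\<close>
  have \<epsilon>y: "\<epsilon> \<le> 1 - ?y 0"
  proof (cases "1 \<le> x 0 * (1 + p)")
    case True
    have "(1 - p) * x 0 < 1"
      using mult_left_le[of "x 0" "1 - p"] opinion_lawsD(2)[OF x, of 0] p by linarith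
    then have growth: "1 \<le> 2 * p * x 0 / (1 - (1 - p) * x 0)"
      using True by (simp add: pos_le_divide_eq algebra_simps)
    note \<epsilon>x
    also have "1 - x 0 \<le> (1 - x 0) * (2 * p * x 0 / (1 - (1 - p) * x 0))"
      using mult_left_mono[OF growth, of "1 - x 0"] opinion_lawsD(2)[OF x, of 0] by simp
    also note decided_ge[OF k x sym p]
    finally show ?thesis .
  next
    case False
    then have "p \<le> (1 - x 0) * (1 + p)" by (simp add: algebra_simps)
    then have "p / (1 + p) \<le> 1 - x 0" using p by (simp add: pos_divide_le_eq)
    then have "p / (1 + p) / real k \<le> (1 - x 0) / real k" by (rule divide_right_mono) simp
    then have "p / (1 + p) / real k \<le> x 1" using x1 by linarith
    then have "p * (p / (1 + p) / real k)\<^sup>2 \<le> p * (x 1)\<^sup>2"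
      using p by (intro mult_left_mono power_mono) auto
    also have "\<dots> \<le> ?y 1" by (rule majority_map_ge_square[OF k x sym p]) (use k in auto)
    finally show ?thesis using \<epsilon>(2) y1 by linarith
  qed
  have y: "?y \<in> opinion_laws k"
  proof -
    have "(\<Sum>i=0..k. ?y i) = 1" using sum by (simp add: sum.atLeast_Suc_atMost)
    moreover have "0 \<le> ?y i" if "i \<le> k" for i using nn[of i] y0 that by (cases "i = 0") auto
    moreover have "?y i = 0" if "i > k" for i using that by (simp add: majority_map_def)
    moreover have "?y 0 < 1" using \<epsilon>y \<epsilon>(1) by linarith
    ultimately show ?thesis by (simp add: opinion_laws_def)
  qed
  have "?y j \<le> \<rho> * (1 - p * (1 - \<rho>0) * (\<epsilon> / real k)\<^sup>2) * ?y 1" if j: "j \<in> {3..k}" for j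
  proof -
    have "\<epsilon> / real k \<le> (1 - x 0) / real k" by (rule divide_right_mono[OF \<epsilon>x]) simp
    then have x1': "\<epsilon> / real k \<le> x 1" using x1 by linarith
    have "p * \<rho> * (1 - \<rho>0) * (\<epsilon> / real k)\<^sup>2 * ?y 1 \<le> p * \<rho> * (1 - \<rho>0) * (\<epsilon> / real k)\<^sup>2"
      by (rule mult_left_le) (use y1 y0 p \<rho> in auto)
    also have "\<dots> \<le> p * \<rho> * (1 - \<rho>) * (x 1)\<^sup>2"
      by (intro mult_mono power_mono x1') (use p \<rho> \<epsilon> in auto)
    finally have "p * \<rho> * (1 - \<rho>0) * (\<epsilon> / real k)\<^sup>2 * ?y 1 \<le> p * \<rho> * (1 - \<rho>) * (x 1)\<^sup>2" .
    moreover have "?y j \<le> \<rho> * ?y 1 - p * \<rho> * (1 - \<rho>) * (x 1)\<^sup>2"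
      by (rule majority_map_ratio[OF k x sym p]) (use j le \<rho> in auto)
    moreover have "\<rho> * ?y 1 - p * \<rho> * (1 - \<rho>0) * (\<epsilon> / real k)\<^sup>2 * ?y 1
        = \<rho> * (1 - p * (1 - \<rho>0) * (\<epsilon> / real k)\<^sup>2) * ?y 1" by algebra
    ultimately show ?thesis by linarith
  qed
  then show ?thesis
    using y \<epsilon>y majority_map_sym[OF k x sym p] by (simp add: leading_pair_def)
qed

text \<open>Two errors proportional to the minor mass \<sigma>: replacing \<open>x 1\<close> by
  \<open>(1 - x 0) / 2\<close> inside \<open>tie_limit\<close> costs the first term of the constant,
  and families with a child of minor opinion cost at most \<open>2 / p * \<sigma>\<close>.\<close>

lemma undecided_approx:
  assumes "2 \<le> k" "x \<in> opinion_laws k" "x 1 = x 2" "0 < p" "p < 1"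
  defines "\<sigma> \<equiv> 1 - (x 0 + 2 * x 1)"
  shows "\<bar>majority_step p k x 0 - tie_limit p (x 0) ((1 - x 0) / 2)\<bar>
      \<le> (1 / ((1 - p)\<^sup>2 * p\<^sup>2) + 2 / p) * \<sigma>"
proof -
  note x = opinion_lawsD[OF assms(2)]
  have \<sigma>: "0 \<le> \<sigma>" "\<sigma> \<le> 1 - x 0"
    using pair_mass_le[OF assms(1-5)] x(1)[of 1] by (simp_all add: \<sigma>_def)
  have x1: "x 1 = (1 - x 0 - \<sigma>) / 2" by (simp add: \<sigma>_def)
  have "0 < p + (1 - p) * \<sigma>" using \<sigma> assms(4,5) by (simp add: add_pos_nonneg)
  then have "1 - p * (1 - \<sigma>)\<^sup>2 / (1 - (1 - p) * (1 - \<sigma>)) = \<sigma> * (1 + p - p * \<sigma>) / (p + (1 - p) * \<sigma>)"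
    by (simp add: field_simps power2_eq_square)
  also have "\<dots> \<le> \<sigma> * 2 / p"
  proof (intro frac_le mult_left_mono)
    have "0 \<le> p * \<sigma>" "0 \<le> (1 - p) * \<sigma>" using \<sigma> assms(4,5) by auto
    then show "1 + p - p * \<sigma> \<le> 2" "p \<le> p + (1 - p) * \<sigma>" using assms(5) by linarith+
  qed (use \<sigma> assms(4) in auto)
  finally have G: "1 - p * (1 - \<sigma>)\<^sup>2 / (1 - (1 - p) * (1 - \<sigma>)) \<le> 2 / p * \<sigma>" by (simp add: mult.commute)
  have "\<bar>tie_limit p (x 0) (x 1) - tie_limit p (x 0) ((1 - x 0) / 2)\<bar> \<le> \<sigma> / ((1 - p)\<^sup>2 * p\<^sup>2)"
    unfolding x1 by (rule tie_limit_perturb[OF assms(4,5) x(1) \<sigma>])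
  moreover have "tie_limit p (x 0) (x 1) \<le> majority_step p k x 0"
    by (rule undecided_ge[OF assms(1-5)])
  moreover have "majority_step p k x 0 \<le> tie_limit p (x 0) (x 1) + 2 / p * \<sigma>"
    using undecided_le[OF assms(1-5)] G unfolding \<sigma>_def by linarith
  moreover have "0 \<le> 2 / p * \<sigma>" using \<sigma> assms(4) by simp
  ultimately show ?thesis by (simp add: distrib_right)
qed

theorem mainTheorem7:
  fixes p \<alpha> :: real and k :: nat and x :: "nat \<Rightarrow> real"
  assumes "0 < p" and "p < 1"
    and "k \<ge> 2"
    and "x \<in> opinion_laws k"
    and "x 1 = x 2"
    and "k \<ge> 3 \<longrightarrow> x 3 < x 2"
    and "\<forall>j. 3 \<le> j \<and> j < k \<longrightarrow> x (Suc j) \<le> x j"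
    and "\<alpha> = (- 3 * p + sqrt (p * (p + 8))) / (4 * (1 - p))"
  shows "\<forall>i\<le>k. (\<lambda>m. (majority_map (geometric_offspring p) k ^^ m) x i) \<longlonglongrightarrow>
           (if i = 0 then \<alpha> else if i = 1 \<or> i = 2 then (1 - \<alpha>) / 2 else 0)"
proof -
  note p = assms(1,2) and k = assms(3) and x = opinion_lawsD[OF assms(4)]
  define X where "X = (\<lambda>m. (majority_step p k ^^ m) x)"
  have x3: "x 3 < x 1" "0 < x 1"
  proof -
    have "x 3 < x 1 \<and> 0 < x 1"
    proof (cases "3 \<le> k")
      case True
      then show ?thesis using assms(5,6) x(1)[of 3] by simp
    next
      case False
      then have "k = 2" using k by simp
      then have "x 3 = 0" using assms(4) by (simp add: opinion_laws_def)
      moreover have "x 1 + x 2 = 1 - x 0" using x(3) \<open>k = 2\<close> by (simp add: numeral_2_eq_2)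
      ultimately show ?thesis using assms(5) x(4) by simp
    qed
    then show "x 3 < x 1" "0 < x 1" by auto
  qed
  \<comment> \<open>The largest initial ratio, because \<open>x 3\<close> dominates the later
    opinions.\<close>
  define \<rho>0 where "\<rho>0 = x 3 / x 1"
  have \<rho>0: "0 \<le> \<rho>0" "\<rho>0 < 1" using x3 x(1)[of 3] by (auto simp: \<rho>0_def)
  \<comment> \<open>The initial decided mass, lowered to what the step lemma can reproduce when
    \<open>x 0\<close> is not close to 1.\<close>
  define \<epsilon> where "\<epsilon> = min (1 - x 0) (p * (p / (1 + p) / real k)\<^sup>2)"
  have \<epsilon>: "0 < \<epsilon>" "\<epsilon> \<le> 1 - x 0" "\<epsilon> \<le> p * (p / (1 + p) / real k)\<^sup>2"
    using x(4) p k by (auto simp: \<epsilon>_def)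
  define b where "b = 1 - p * (1 - \<rho>0) * (\<epsilon> / real k)\<^sup>2"
  have b: "0 \<le> b" "b < 1"
  proof -
    have "\<epsilon> \<le> 1" using \<epsilon>(2) x(1)[of 0] by linarith
    then have "\<epsilon> / real k \<le> 1" using k by simp
    then have "(\<epsilon> / real k)\<^sup>2 \<le> 1" using \<epsilon>(1) by (intro power_le_one) auto
    then have "p * (1 - \<rho>0) * (\<epsilon> / real k)\<^sup>2 \<le> 1 * 1 * 1"
      by (intro mult_mono) (use p \<rho>0 in auto)
    then show "0 \<le> b" by (simp add: b_def)
    show "b < 1" using p \<rho>0 \<epsilon>(1) k by (simp add: b_def)
  qed
  have "x j \<le> x 3" if "3 \<le> j" "j \<le> k" for j
    using that by (induction j rule: dec_induct) (use assms(7) order_trans in fastforce)+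
  then have lp0: "leading_pair k \<epsilon> \<rho>0 x"
    using assms(4,5) \<epsilon>(2) x3 by (auto simp: leading_pair_def \<rho>0_def)
  have lp: "leading_pair k \<epsilon> (\<rho>0 * b ^ m) (X m)" for m
  proof (induction m)
    case (Suc m)
    have "leading_pair k \<epsilon> (\<rho>0 * b ^ m * (1 - p * (1 - \<rho>0) * (\<epsilon> / real k)\<^sup>2))
        (majority_step p k (X m))"
    proof (rule leading_pair_step[OF Suc k p _ _ _ \<epsilon>(1,3)])
      show "\<rho>0 * b ^ m \<le> \<rho>0" by (intro mult_left_le power_le_one) (use \<rho>0 b in auto)
    qed (use \<rho>0 b in auto)
    then show ?case
      unfolding b_def[symmetric] by (simp add: X_def mult_ac)
  qed (simp add: X_def lp0)
  have XL: "X m \<in> opinion_laws k" and Xsym: "X m 1 = X m 2" and X\<epsilon>: "X m 0 \<le> 1 - \<epsilon>"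
    and Xle: "j \<in> {3..k} \<Longrightarrow> X m j \<le> \<rho>0 * b ^ m * X m 1" for m j
    using lp[of m] by (auto simp: leading_pair_def)
  note X = opinion_lawsD[OF XL]
  have \<rho>lim: "(\<lambda>m. \<rho>0 * b ^ m) \<longlonglongrightarrow> 0"
    using tendsto_mult[OF tendsto_const LIMSEQ_power_zero[of b], of \<rho>0] b by simp
  have tail: "0 \<le> X m j" "X m j \<le> \<rho>0 * b ^ m" if "j \<in> {3..k}" for m j
  proof -
    show "0 \<le> X m j" by (rule X(1))
    have "\<rho>0 * b ^ m * X m 1 \<le> \<rho>0 * b ^ m"
      by (rule mult_left_le[OF X(2)]) (use \<rho>0 b in simp)
    then show "X m j \<le> \<rho>0 * b ^ m" using Xle[OF that, of m] by linarith
  qed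
  have tail_lim: "(\<lambda>m. X m j) \<longlonglongrightarrow> 0" if "j \<in> {3..k}" for j
    by (rule tendsto_sandwich[OF _ _ tendsto_const \<rho>lim]) (use tail[OF that] in auto)
  define \<sigma> where "\<sigma> = (\<lambda>m. 1 - (X m 0 + 2 * X m 1))"
  have "\<sigma> = (\<lambda>m. \<Sum>j=3..k. X m j)"
  proof
    fix m
    show "\<sigma> m = (\<Sum>j=3..k. X m j)"
      using X(3)[of m] sum_split_2[OF k, of "X m"] Xsym[of m] by (simp add: \<sigma>_def)
  qed
  then have \<sigma>lim: "\<sigma> \<longlonglongrightarrow> 0" using tendsto_sum[of "{3..k}" "\<lambda>j m. X m j" "\<lambda>_. 0"] tail_lim by simp
  \<comment> \<open>The invariant keeps every \<open>X m 0\<close> below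
    \<open>1 - \<epsilon>\<close>, away from the fixed point 1, so one contraction constant serves
    all \<open>m\<close>.\<close>
  obtain c where c: "0 \<le> c" "c < 1"
    "\<And>s. 0 \<le> s \<Longrightarrow> s \<le> 1 - \<epsilon> \<Longrightarrow> \<bar>tie_limit p s ((1 - s) / 2) - \<alpha>\<bar> \<le> c * \<bar>s - \<alpha>\<bar>"
    using tie_limit_contraction[OF p \<epsilon>(1) assms(8)] by metis
  let ?C = "1 / ((1 - p)\<^sup>2 * p\<^sup>2) + 2 / p"
  \<comment> \<open>The distance to \<alpha> contracts by \<open>c\<close> up to an error
    \<open>?C * \<sigma> m\<close>, which vanishes because the minor opinions die out.\<close>
  have "(\<lambda>m. \<bar>X m 0 - \<alpha>\<bar>) \<longlonglongrightarrow> 0"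
  proof (rule perturbed_contraction_tendsto_0[OF _ c(1,2)])
    fix m
    have "\<bar>X (Suc m) 0 - tie_limit p (X m 0) ((1 - X m 0) / 2)\<bar> \<le> ?C * \<sigma> m"
      using undecided_approx[OF k XL Xsym p, of m] by (simp add: X_def \<sigma>_def)
    then show "\<bar>X (Suc m) 0 - \<alpha>\<bar> \<le> c * \<bar>X m 0 - \<alpha>\<bar> + ?C * \<sigma> m"
      using c(3)[OF X(1) X\<epsilon>, of m] by linarith
    show "(\<lambda>m. ?C * \<sigma> m) \<longlonglongrightarrow> 0" using tendsto_mult[OF tendsto_const \<sigma>lim, of ?C] by simp
  qed simp
  then have X0: "(\<lambda>m. X m 0) \<longlonglongrightarrow> \<alpha>"
    by (simp add: tendsto_rabs_zero_iff LIM_zero_iff)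
  have X1: "(\<lambda>m. X m 1) \<longlonglongrightarrow> (1 - \<alpha>) / 2"
  proof -
    have "(\<lambda>m. (1 - X m 0 - \<sigma> m) / 2) \<longlonglongrightarrow> (1 - \<alpha> - 0) / 2"
      by (intro tendsto_intros X0 \<sigma>lim) simp
    then show ?thesis by (simp add: \<sigma>_def)
  qed
  have "(\<lambda>m. X m i) \<longlonglongrightarrow> (if i = 0 then \<alpha> else if i = 1 \<or> i = 2 then (1 - \<alpha>) / 2 else 0)"
    if "i \<le> k" for i
  proof -
    have "i = 0 \<or> i = 1 \<or> i = 2 \<or> i \<in> {3..k}"
      using that unfolding atLeastAtMost_iff by linarith
    then consider "i = 0" | "i = 1" | "i = 2" | "i \<in> {3..k}" by blast
    then show ?thesis
      using X0 X1 Xsym tail_lim[of i] by cases auto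
  qed
  then show ?thesis by (simp add: X_def)
qed

end
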